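(* Let $V_T\big(\Pi_T(\Delta_T,\Lambda_T^{1:K})\big):=\mathbb E^{\mathbf g}[c_T(X_T)\mid\Pi_T=\pi_T]$ and, for $t=T-1,\dots,0$, $$V_t\big(\Pi_t(\Delta_t,\Lambda_t^{1:K})\big):=\inf_{u_t^{1:K}\in\prod_{k\in\mathcal K}\mathcal U_t^k}\mathbb E^{\mathbf g}\Big[c_t(X_t,U_t^{1:K})+V_{t+1}\big(\theta_t[\Pi_t(\Delta_t,\Lambda_t^{1:K}),Y_{t+1}^{1:K},U_t^{1:K}]\big)\,\Big|\,\Pi_t=\pi_t,\,U_t^{1:K}=u_t^{1:K}\Big],$$ where $\pi_t,u_t^{1:K}$ are the realizations of $\Pi_t,U_t^{1:K}$, and let $\mathbf g\in\mathcal G^s$ be a separated control strategy that achieves the infimum in this recursion (for every $t$). Then $\mathbf g$ is optimal, i.e., it minimizes $J(\mathbf g')=\mathbb E^{\mathbf g'}\big[\sum_{t=0}^{T-1}c_t(X_t,U_t^{1:K})+c_T(X_T)\big]$ over $\mathbf g'\in\mathcal G$, and $$V_t\big(\Pi_t(\Delta_t,\Lambda_t^{1:K})\big)=J_t(\mathbf g)$$ with probability $1$, where $J_t(\mathbf g):=\mathbb E^{\mathbf g}\big[\sum_{l=t}^{T-1}c_l(X_l,U_l^{1:K})+c_T(X_T)\mid\Delta_t,\Lambda_t^{1:K}\big]$ is the cost-to-go at time $t$.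
   Context: Model. $K,T\in\mathbb N$, $\mathcal K=\{1,\dots,K\}$; all random variables are defined on a probability space $(\Omega,\mathscr F,\mathbb P)$. The state $X_t$ takes values in a measurable space $(\mathcal X_t,\mathscr X_t)$, $t=0,\dots,T$; the decision $U_t^k$ of member $k\in\mathcal K$ takes values in a measurable space $(\mathcal U_t^k,\mathscr U_t^k)$ with $\mathcal U_t^k\neq\emptyset$, $t=0,\dots,T-1$. The state evolves by $X_{t+1}=f_t(X_t,U_t^{1:K},W_t)$, and member $k$ observes $Y_t^k=h_t^k(X_t,Z_t^k)$ with values in $(\mathcal Y^k,\mathscr Y^k)$. $\{W_t\}$ is a sequence of independent random variables, independent of $X_0$; $\{Z_t^k\}_{t,k}$ are independent random variables, independent of $X_0$ and of $\{W_t\}$. The costs $c_t:\mathcal X_t\times\prod_k\mathcal U_t^k\to\mathbb R$ ($t<T$) and $c_T:\mathcal X_T\to\mathbb R$ are measurable. Notation. $A^{1:K}=(A^1,\dots,A^K)$ and $A_{s:t}=(A_s,\dots,A_t)$ (negative time indices are omitted). Information structure ($n$-step delayed sharing, $n\ge 1$ an integer). $\Delta_t=(Y_{0:t-n}^{1:K},U_{0:t-n}^{1:K})$ is known to all members; $\Lambda_t^k=(Y_{t-n+1:t}^k,U_{t-n+1:t-1}^k)$ is known only to member $k$. These take values in measurable spaces $(\mathcal D_t,\mathscr D_t)$ and $(\mathcal L_t^k,\mathscr L_t^k)$. Strategies. $\mathcal G$ is the set of centralized strategies $\mathbf g=\{g_t\}_{t=0}^{T-1}$, where $g_t$ is a measurable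 map from $\mathcal L_t^1\times\dots\times\mathcal L_t^K\times\mathcal D_t$ to $\prod_{k}\mathcal U_t^k$ and $U_t^{1:K}=g_t(\Lambda_t^{1:K},\Delta_t)$. Densities. All probability distributions are assumed to have (conditional) densities $p$. A superscript $\mathbf g$ indicates that the quantity is computed under strategy $\mathbf g$; absence of the superscript indicates that it does not depend on the choice of $\mathbf g$. Information state. $\Pi_t=\Pi_t(\Delta_t,\Lambda_t^{1:K})$ is the conditional density $p(X_t=\cdot\mid\Delta_t,\Lambda_t^{1:K})$ on $\mathcal X_t$ (it does not depend on $\mathbf g$). The update map $\theta_t$, satisfying $\Pi_{t+1}=\theta_t[\Pi_t,Y_{t+1}^{1:K},U_t^{1:K}]$, is $$\theta_t[\pi,y,u](x')=\frac{p(Y_{t+1}^{1:K}=y\mid X_{t+1}=x')\int_{\mathcal X_t}p(X_{t+1}=x'\mid X_t=x,U_t^{1:K}=u)\,\pi(x)\,dx}{\int_{\mathcal X_{t+1}}p(Y_{t+1}^{1:K}=y\mid X_{t+1}=x'')\int_{\mathcal X_t}p(X_{t+1}=x''\mid X_t=x,U_t^{1:K}=u)\,\pi(x)\,dx\,dx''}.$$ Separated strategies. $\mathbf g\in\mathcal G$ is separated if $g_t$ depends on $(\Delta_t,\Lambda_t^{1:K})$ only through the information state, i.e., $U_t^{1:K}=g_t(\Pi_t(\Delta_t,\Lambda_t^{1:K}))$; $\mathcal G^s\subseteq\mathcal G$ is the set of separated strategies.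
   Formalization: The costs are additionally assumed to have integrable negative parts at every stage and at the final time under every strategy in G, since otherwise J(g') may be undefined (∞ − ∞); expectations may equal +∞. *)

theory Defs
  imports "HOL-Probability.Probability"
begin

text \<open>
  Members are \<open>1, \<dots>, members S\<close>. Spaces that vary with time or member are given as measures
  on a common universe type, each with its own carrier. For decisions, noises and information
  only the measurable structure is relevant; for \<open>state_space\<close> and \<open>obs_space\<close> the measure
  is moreover the reference measure with respect to which densities are taken.
\<close>

record ('o, 'x, 'u, 'y, 'w, 'z) system =
  sample_space :: "'o measure"
  members :: nat
  horizon :: nat
  delay :: nat
  state_space :: "nat \<Rightarrow> 'x measure"
  decision_space :: "nat \<Rightarrow> nat \<Rightarrow> 'u measure"
  obs_space :: "nat \<Rightarrow> 'y measure"
  state_noise_space :: "nat \<Rightarrow> 'w measure"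
  obs_noise_space :: "nat \<Rightarrow> nat \<Rightarrow> 'z measure"
  initial_state :: "'o \<Rightarrow> 'x"
  state_noise :: "nat \<Rightarrow> 'o \<Rightarrow> 'w"
  obs_noise :: "nat \<Rightarrow> nat \<Rightarrow> 'o \<Rightarrow> 'z"
  dynamics :: "nat \<Rightarrow> 'x \<Rightarrow> (nat \<Rightarrow> 'u) \<Rightarrow> 'w \<Rightarrow> 'x"
  observation :: "nat \<Rightarrow> nat \<Rightarrow> 'x \<Rightarrow> 'z \<Rightarrow> 'y"
  stage_cost :: "nat \<Rightarrow> 'x \<Rightarrow> (nat \<Rightarrow> 'u) \<Rightarrow> real"
  final_cost :: "'x \<Rightarrow> real"
  initial_density :: "'x \<Rightarrow> ennreal"
  transition_density :: "nat \<Rightarrow> 'x \<Rightarrow> (nat \<Rightarrow> 'u) \<Rightarrow> 'x \<Rightarrow> ennreal"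
  obs_density :: "nat \<Rightarrow> 'x \<Rightarrow> (nat \<Rightarrow> 'y) \<Rightarrow> ennreal"

definition joint_decision_space ::
    "('o, 'x, 'u, 'y, 'w, 'z) system \<Rightarrow> nat \<Rightarrow> (nat \<Rightarrow> 'u) measure" where
  "joint_decision_space S t = PiM {1..members S} (decision_space S t)"

definition joint_obs_space ::
    "('o, 'x, 'u, 'y, 'w, 'z) system \<Rightarrow> (nat \<Rightarrow> 'y) measure" where
  "joint_obs_space S = PiM {1..members S} (obs_space S)"

definition observe ::
    "('o, 'x, 'u, 'y, 'w, 'z) system \<Rightarrow> nat \<Rightarrow> 'x \<Rightarrow> 'o \<Rightarrow> nat \<Rightarrow> 'y" where
  "observe S t x \<omega> = (\<lambda>k\<in>{1..members S}. observation S t k x (obs_noise S t k \<omega>))"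

text \<open>
  Since \<open>W\<^sub>t\<close> is independent of \<open>(X\<^sub>t, U\<^sub>t)\<close> and \<open>Z\<^sub>t\<close> of \<open>X\<^sub>t\<close>, the conditional densities
  \<open>p(X\<^sub>t\<^sub>+\<^sub>1 = \<cdot> | X\<^sub>t = x, U\<^sub>t = u)\<close> and \<open>p(Y\<^sub>t = \<cdot> | X\<^sub>t = x)\<close> are the densities of
  \<open>f\<^sub>t(x, u, W\<^sub>t)\<close> and of \<open>(h\<^sub>t\<^sup>k(x, Z\<^sub>t\<^sup>k))\<^sub>k\<close>, which makes them meaningful at every \<open>x\<close> and \<open>u\<close>.
\<close>

locale delayed_sharing = prob_space "sample_space S"
  for S :: "('o, 'x, 'u, 'y, 'w, 'z) system" +
  assumes delay_ge_1: "1 \<le> delay S"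
    and decision_nonempty:
      "\<And>t k. t < horizon S \<Longrightarrow> k \<in> {1..members S} \<Longrightarrow> space (decision_space S t k) \<noteq> {}"
    and sigma_finite_state: "\<And>t. t \<le> horizon S \<Longrightarrow> sigma_finite_measure (state_space S t)"
    and sigma_finite_obs: "\<And>k. k \<in> {1..members S} \<Longrightarrow> sigma_finite_measure (obs_space S k)"
    and dynamics_measurable: "\<And>t. t < horizon S \<Longrightarrow>
      (\<lambda>(x, u, w). dynamics S t x u w) \<in>
        state_space S t \<Otimes>\<^sub>M (joint_decision_space S t \<Otimes>\<^sub>M state_noise_space S t)
          \<rightarrow>\<^sub>M state_space S (Suc t)"
    and observation_measurable: "\<And>t k. t \<le> horizon S \<Longrightarrow> k \<in> {1..members S} \<Longrightarrow>
      (\<lambda>(x, z). observation S t k x z) \<in>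
        state_space S t \<Otimes>\<^sub>M obs_noise_space S t k \<rightarrow>\<^sub>M obs_space S k"
    and stage_cost_measurable: "\<And>t. t < horizon S \<Longrightarrow>
      (\<lambda>(x, u). stage_cost S t x u) \<in>
        borel_measurable (state_space S t \<Otimes>\<^sub>M joint_decision_space S t)"
    and final_cost_measurable: "final_cost S \<in> borel_measurable (state_space S (horizon S))"
    and state_noise_indep:
      "indep_vars (state_noise_space S) (state_noise S) {..<horizon S}"
    and state_noise_indep_initial:
      "indep_set
         (sets (vimage_algebra (space (sample_space S)) (initial_state S) (state_space S 0)))
         (sets (vimage_algebra (space (sample_space S))
           (\<lambda>\<omega>. \<lambda>t\<in>{..<horizon S}. state_noise S t \<omega>) (PiM {..<horizon S} (state_noise_space S))))"
    and obs_noise_indep: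
      "indep_vars (\<lambda>(t, k). obs_noise_space S t k) (\<lambda>(t, k). obs_noise S t k)
         ({..horizon S} \<times> {1..members S})"
    and obs_noise_indep_rest:
      "indep_set
         (sets (vimage_algebra (space (sample_space S))
           (\<lambda>\<omega>. \<lambda>(t, k)\<in>{..horizon S} \<times> {1..members S}. obs_noise S t k \<omega>)
           (PiM ({..horizon S} \<times> {1..members S}) (\<lambda>(t, k). obs_noise_space S t k))))
         (sets (vimage_algebra (space (sample_space S))
           (\<lambda>\<omega>. (initial_state S \<omega>, \<lambda>t\<in>{..<horizon S}. state_noise S t \<omega>))
           (state_space S 0 \<Otimes>\<^sub>M PiM {..<horizon S} (state_noise_space S))))"
    and initial_density:
      "distributed (sample_space S) (state_space S 0) (initial_state S) (initial_density S)"
    and transition_density_measurable: "\<And>t. t < horizon S \<Longrightarrow>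
      (\<lambda>(x, u, x'). transition_density S t x u x') \<in> borel_measurable
        (state_space S t \<Otimes>\<^sub>M (joint_decision_space S t \<Otimes>\<^sub>M state_space S (Suc t)))"
    and transition_density: "\<And>t x u. t < horizon S \<Longrightarrow>
      x \<in> space (state_space S t) \<Longrightarrow> u \<in> space (joint_decision_space S t) \<Longrightarrow>
      distributed (sample_space S) (state_space S (Suc t))
        (\<lambda>\<omega>. dynamics S t x u (state_noise S t \<omega>)) (transition_density S t x u)"
    and obs_density_measurable: "\<And>t. t \<le> horizon S \<Longrightarrow>
      (\<lambda>(x, y). obs_density S t x y) \<in>
        borel_measurable (state_space S t \<Otimes>\<^sub>M joint_obs_space S)"
    and obs_density: "\<And>t x. t \<le> horizon S \<Longrightarrow> x \<in> space (state_space S t) \<Longrightarrow>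
      distributed (sample_space S) (joint_obs_space S) (observe S t x) (obs_density S t x)"

text \<open>
  The information \<open>(\<Lambda>\<^sub>t\<^sup>1\<^sup>:\<^sup>K, \<Delta>\<^sub>t)\<close>. The index sets express \<open>0:t-n\<close>, \<open>t-n+1:t\<close> and
  \<open>t-n+1:t-1\<close> without subtraction, so that negative times are omitted.
\<close>

type_synonym ('u, 'y) info =
  "(nat \<Rightarrow> (nat \<Rightarrow> 'y) \<times> (nat \<Rightarrow> 'u)) \<times> ((nat \<Rightarrow> nat \<Rightarrow> 'y) \<times> (nat \<Rightarrow> nat \<Rightarrow> 'u))"

type_synonym ('u, 'y) strategy = "nat \<Rightarrow> ('u, 'y) info \<Rightarrow> nat \<Rightarrow> 'u"

definition private_space ::
    "('o, 'x, 'u, 'y, 'w, 'z) system \<Rightarrow> nat \<Rightarrow> nat \<Rightarrow> ((nat \<Rightarrow> 'y) \<times> (nat \<Rightarrow> 'u)) measure" where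
  "private_space S t k =
     PiM {s. s \<le> t \<and> t < s + delay S} (\<lambda>s. obs_space S k) \<Otimes>\<^sub>M
     PiM {s. s < t \<and> t < s + delay S} (\<lambda>s. decision_space S s k)"

definition shared_space ::
    "('o, 'x, 'u, 'y, 'w, 'z) system \<Rightarrow> nat
      \<Rightarrow> ((nat \<Rightarrow> nat \<Rightarrow> 'y) \<times> (nat \<Rightarrow> nat \<Rightarrow> 'u)) measure" where
  "shared_space S t =
     PiM {s. s + delay S \<le> t} (\<lambda>s. joint_obs_space S) \<Otimes>\<^sub>M
     PiM {s. s + delay S \<le> t} (\<lambda>s. joint_decision_space S s)"

definition info_space ::
    "('o, 'x, 'u, 'y, 'w, 'z) system \<Rightarrow> nat \<Rightarrow> ('u, 'y) info measure" where
  "info_space S t = PiM {1..members S} (private_space S t) \<Otimes>\<^sub>M shared_space S t"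

definition info ::
    "('o, 'x, 'u, 'y, 'w, 'z) system \<Rightarrow> nat
      \<Rightarrow> (nat \<Rightarrow> nat \<Rightarrow> 'y) \<Rightarrow> (nat \<Rightarrow> nat \<Rightarrow> 'u) \<Rightarrow> ('u, 'y) info" where
  "info S t y u =
     ((\<lambda>k\<in>{1..members S}.
        (\<lambda>s\<in>{s. s \<le> t \<and> t < s + delay S}. y s k, \<lambda>s\<in>{s. s < t \<and> t < s + delay S}. u s k)),
      (\<lambda>s\<in>{s. s + delay S \<le> t}. y s, \<lambda>s\<in>{s. s + delay S \<le> t}. u s))"

definition strategies ::
    "('o, 'x, 'u, 'y, 'w, 'z) system \<Rightarrow> ('u, 'y) strategy set" where
  "strategies S = {g. \<forall>t<horizon S. g t \<in> info_space S t \<rightarrow>\<^sub>M joint_decision_space S t}"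

text \<open>
  \<open>trajectory S g \<omega> t\<close> consists of \<open>X\<^sub>t\<close>, of \<open>Y\<^sub>s\<close> for \<open>s \<le> t\<close> and of \<open>U\<^sub>s\<close> for \<open>s < t\<close>
  under the strategy \<open>g\<close>; later entries of the two histories are unset.
\<close>

primrec trajectory ::
    "('o, 'x, 'u, 'y, 'w, 'z) system \<Rightarrow> ('u, 'y) strategy \<Rightarrow> 'o \<Rightarrow> nat
      \<Rightarrow> 'x \<times> (nat \<Rightarrow> nat \<Rightarrow> 'y) \<times> (nat \<Rightarrow> nat \<Rightarrow> 'u)" where
  "trajectory S g \<omega> 0 =
     (let x = initial_state S \<omega>
      in (x, (\<lambda>_. undefined)(0 := observe S 0 x \<omega>), \<lambda>_. undefined))"
| "trajectory S g \<omega> (Suc t) =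
     (let (x, y, u) = trajectory S g \<omega> t;
          a = g t (info S t y u);
          x' = dynamics S t x a (state_noise S t \<omega>)
      in (x', y(Suc t := observe S (Suc t) x' \<omega>), u(t := a)))"

definition state ::
    "('o, 'x, 'u, 'y, 'w, 'z) system \<Rightarrow> ('u, 'y) strategy \<Rightarrow> nat \<Rightarrow> 'o \<Rightarrow> 'x" where
  "state S g t \<omega> = fst (trajectory S g \<omega> t)"

definition information ::
    "('o, 'x, 'u, 'y, 'w, 'z) system \<Rightarrow> ('u, 'y) strategy \<Rightarrow> nat \<Rightarrow> 'o \<Rightarrow> ('u, 'y) info" where
  "information S g t \<omega> = (case trajectory S g \<omega> t of (x, y, u) \<Rightarrow> info S t y u)"

definition decision ::
    "('o, 'x, 'u, 'y, 'w, 'z) system \<Rightarrow> ('u, 'y) strategy \<Rightarrow> nat \<Rightarrow> 'o \<Rightarrow> nat \<Rightarrow> 'u" where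
  "decision S g t \<omega> = g t (information S g t \<omega>)"

text \<open>
  \<open>p c\<close> is the density of \<open>X\<close> with respect to \<open>N\<close> conditionally on \<open>C = c\<close>.
\<close>

definition conditional_density ::
    "'a measure \<Rightarrow> 'c measure \<Rightarrow> ('a \<Rightarrow> 'c) \<Rightarrow> 'b measure \<Rightarrow> ('a \<Rightarrow> 'b)
      \<Rightarrow> ('c \<Rightarrow> 'b \<Rightarrow> ennreal) \<Rightarrow> bool" where
  "conditional_density M L C N X p \<longleftrightarrow>
     C \<in> M \<rightarrow>\<^sub>M L \<and> X \<in> M \<rightarrow>\<^sub>M N \<and> (\<lambda>(c, x). p c x) \<in> borel_measurable (L \<Otimes>\<^sub>M N) \<and>
     (\<forall>A\<in>sets L. \<forall>B\<in>sets N.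
        emeasure M {\<omega> \<in> space M. C \<omega> \<in> A \<and> X \<omega> \<in> B} =
        (\<integral>\<^sup>+\<omega>. indicator A (C \<omega>) * (\<integral>\<^sup>+x. indicator B x * p (C \<omega>) x \<partial>N) \<partial>M))"

definition filter_update ::
    "('o, 'x, 'u, 'y, 'w, 'z) system \<Rightarrow> nat \<Rightarrow> ('x \<Rightarrow> ennreal) \<Rightarrow> (nat \<Rightarrow> 'y) \<Rightarrow> (nat \<Rightarrow> 'u)
      \<Rightarrow> 'x \<Rightarrow> ennreal" where
  "filter_update S t \<pi> y u = (\<lambda>x'\<in>space (state_space S (Suc t)).
     obs_density S (Suc t) x' y *
       (\<integral>\<^sup>+x. transition_density S t x u x' * \<pi> x \<partial>state_space S t) /
     (\<integral>\<^sup>+x''. obs_density S (Suc t) x'' y *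
       (\<integral>\<^sup>+x. transition_density S t x u x'' * \<pi> x \<partial>state_space S t) \<partial>state_space S (Suc t)))"

text \<open>
  A conditional density is determined only up to null sets. An information state (written \<open>\<Psi>\<close>,
  since \<open>\<Pi>\<close> is reserved syntax) is a version
  that serves all strategies simultaneously and obeys the update map at every realization of the
  information, not just almost surely. Such a version always exists: take Bayes' formula at time
  \<open>0\<close> and iterate the update map. Densities are extensional functions, so that a map applied to
  them can only see their values on the state space.
\<close>

definition information_state ::
    "('o, 'x, 'u, 'y, 'w, 'z) system \<Rightarrow> (nat \<Rightarrow> ('u, 'y) info \<Rightarrow> 'x \<Rightarrow> ennreal) \<Rightarrow> bool" where
  "information_state S \<Psi> \<longleftrightarrow>
     (\<forall>t\<le>horizon S. \<forall>i\<in>space (info_space S t). \<Psi> t i \<in> extensional (space (state_space S t))) \<and>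
     (\<forall>g\<in>strategies S. \<forall>t\<le>horizon S.
        conditional_density (sample_space S) (info_space S t) (information S g t)
          (state_space S t) (state S g t) (\<Psi> t)) \<and>
     (\<forall>t<horizon S.
        \<forall>y\<in>space (PiM {..Suc t} (\<lambda>s. joint_obs_space S)).
        \<forall>u\<in>space (PiM {..t} (joint_decision_space S)).
          \<Psi> (Suc t) (info S (Suc t) y u) =
          filter_update S t (\<Psi> t (info S t y u)) (y (Suc t)) (u t))"

definition separated_strategies ::
    "('o, 'x, 'u, 'y, 'w, 'z) system \<Rightarrow> (nat \<Rightarrow> ('u, 'y) info \<Rightarrow> 'x \<Rightarrow> ennreal)
      \<Rightarrow> ('u, 'y) strategy set" where
  "separated_strategies S \<Psi> = {g \<in> strategies S.
     \<forall>t<horizon S. \<exists>\<gamma> :: ('x \<Rightarrow> ennreal) \<Rightarrow> nat \<Rightarrow> 'u.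
       \<forall>i\<in>space (info_space S t). g t i = \<gamma> (\<Psi> t i)}"

text \<open>
  Extended-valued expectation \<open>E[f\<^sup>+] - E[f\<^sup>-]\<close> and its conditional counterpart; \<open>e2ennreal\<close>
  truncates negative values to \<open>0\<close>.
\<close>

definition ext_expectation :: "'a measure \<Rightarrow> ('a \<Rightarrow> ereal) \<Rightarrow> ereal" where
  "ext_expectation M f =
     enn2ereal (\<integral>\<^sup>+\<omega>. e2ennreal (f \<omega>) \<partial>M) - enn2ereal (\<integral>\<^sup>+\<omega>. e2ennreal (- f \<omega>) \<partial>M)"

definition ext_cond_exp :: "'a measure \<Rightarrow> 'a measure \<Rightarrow> ('a \<Rightarrow> ereal) \<Rightarrow> 'a \<Rightarrow> ereal" where
  "ext_cond_exp M F f \<omega> =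
     enn2ereal (nn_cond_exp M F (\<lambda>\<omega>. e2ennreal (f \<omega>)) \<omega>) -
     enn2ereal (nn_cond_exp M F (\<lambda>\<omega>. e2ennreal (- f \<omega>)) \<omega>)"

definition cost_from ::
    "('o, 'x, 'u, 'y, 'w, 'z) system \<Rightarrow> ('u, 'y) strategy \<Rightarrow> nat \<Rightarrow> 'o \<Rightarrow> real" where
  "cost_from S g t \<omega> =
     (\<Sum>l\<in>{t..<horizon S}. stage_cost S l (state S g l \<omega>) (decision S g l \<omega>)) +
     final_cost S (state S g (horizon S) \<omega>)"

definition total_cost ::
    "('o, 'x, 'u, 'y, 'w, 'z) system \<Rightarrow> ('u, 'y) strategy \<Rightarrow> ereal" where
  "total_cost S g = ext_expectation (sample_space S) (\<lambda>\<omega>. ereal (cost_from S g 0 \<omega>))"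

definition cost_to_go ::
    "('o, 'x, 'u, 'y, 'w, 'z) system \<Rightarrow> ('u, 'y) strategy \<Rightarrow> nat \<Rightarrow> 'o \<Rightarrow> ereal" where
  "cost_to_go S g t = ext_cond_exp (sample_space S)
     (vimage_algebra (space (sample_space S)) (information S g t) (info_space S t))
     (\<lambda>\<omega>. ereal (cost_from S g t \<omega>))"

text \<open>
  Under this condition every expected cost is well defined, possibly equal to \<open>\<infinity>\<close>.
\<close>

definition costs_quasi_integrable :: "('o, 'x, 'u, 'y, 'w, 'z) system \<Rightarrow> bool" where
  "costs_quasi_integrable S \<longleftrightarrow> (\<forall>g\<in>strategies S.
     (\<forall>t<horizon S.
       (\<integral>\<^sup>+\<omega>. ennreal (- stage_cost S t (state S g t \<omega>) (decision S g t \<omega>))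
          \<partial>sample_space S) < \<infinity>) \<and>
     (\<integral>\<^sup>+\<omega>. ennreal (- final_cost S (state S g (horizon S) \<omega>)) \<partial>sample_space S) < \<infinity>)"

text \<open>
  The conditional law of \<open>(X\<^sub>t, X\<^sub>t\<^sub>+\<^sub>1, Y\<^sub>t\<^sub>+\<^sub>1)\<close> given \<open>\<Psi>\<^sub>t = \<pi>\<close> and \<open>U\<^sub>t = u\<close>. The infimum in the
  recursion also runs over decisions \<open>u\<close> that the strategy in force never takes, so conditioning
  on \<open>U\<^sub>t = u\<close> has to be read through the model's conditional densities.
\<close>

definition one_step_law ::
    "('o, 'x, 'u, 'y, 'w, 'z) system \<Rightarrow> nat \<Rightarrow> ('x \<Rightarrow> ennreal) \<Rightarrow> (nat \<Rightarrow> 'u)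
      \<Rightarrow> ('x \<times> 'x \<times> (nat \<Rightarrow> 'y)) measure" where
  "one_step_law S t \<pi> u =
     density (state_space S t \<Otimes>\<^sub>M (state_space S (Suc t) \<Otimes>\<^sub>M joint_obs_space S))
       (\<lambda>(x, x', y). \<pi> x * transition_density S t x u x' * obs_density S (Suc t) x' y)"

definition lookahead_cost ::
    "('o, 'x, 'u, 'y, 'w, 'z) system \<Rightarrow> nat \<Rightarrow> (('x \<Rightarrow> ennreal) \<Rightarrow> ereal)
      \<Rightarrow> ('x \<Rightarrow> ennreal) \<Rightarrow> (nat \<Rightarrow> 'u) \<Rightarrow> ereal" where
  "lookahead_cost S t v \<pi> u = ext_expectation (one_step_law S t \<pi> u)
     (\<lambda>(x, x', y). ereal (stage_cost S t x u) + v (filter_update S t \<pi> y u))"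

function value_function ::
    "('o, 'x, 'u, 'y, 'w, 'z) system \<Rightarrow> nat \<Rightarrow> ('x \<Rightarrow> ennreal) \<Rightarrow> ereal" where
  "value_function S t =
     (if t < horizon S
      then (\<lambda>\<pi>. INF u\<in>space (joint_decision_space S t).
                  lookahead_cost S t (value_function S (Suc t)) \<pi> u)
      else (\<lambda>\<pi>. ext_expectation (density (state_space S (horizon S)) \<pi>)
                  (\<lambda>x. ereal (final_cost S x))))"
  by auto
termination
  by (relation "Wellfounded.measure (\<lambda>(S, t). horizon S - t)") auto

declare value_function.simps [simp del]

definition achieves_infimum ::
    "('o, 'x, 'u, 'y, 'w, 'z) system \<Rightarrow> (nat \<Rightarrow> ('u, 'y) info \<Rightarrow> 'x \<Rightarrow> ennreal)
      \<Rightarrow> ('u, 'y) strategy \<Rightarrow> bool" where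
  "achieves_infimum S \<Psi> g \<longleftrightarrow> (\<forall>t<horizon S. \<forall>i\<in>space (info_space S t).
     lookahead_cost S t (value_function S (Suc t)) (\<Psi> t i) (g t i) =
     value_function S t (\<Psi> t i))"

end

theory Submission
  imports Defs
begin

text \<open>
  Backward induction on the time. For every strategy \<open>h\<close>, the noise at a step is independent of the
  past, so given the information at time \<open>t\<close> the law of \<open>(X\<^sub>t, X\<^sub>t\<^sub>+\<^sub>1, Y\<^sub>t\<^sub>+\<^sub>1)\<close> is the one-step law at
  the information state and the decision taken. Together with the update map this turns the
  conditional expectation of \<open>c\<^sub>t + V\<^sub>t\<^sub>+\<^sub>1\<close> into the lookahead cost, which dominates \<open>V\<^sub>t\<close>, with
  equality if \<open>h\<close> decides as \<open>g\<close> at time \<open>t\<close>. Hence \<open>V\<^sub>t\<close> bounds the cost-to-go of \<open>h\<close> from below,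
  with equality if \<open>h\<close> agrees with \<open>g\<close> from \<open>t\<close> on. Two points need care.
  The value function of a density need not be measurable, but its composition with the information
  state is: by attainment it is the lookahead cost at \<open>g\<close>, an integral of a jointly measurable
  function. And additivity of extended-valued expectations needs integrable negative parts; for
  \<open>V\<^sub>t\<close> this comes from the strategy that follows \<open>h\<close> before \<open>t\<close> and \<open>g\<close> from \<open>t\<close> on.
\<close>

section \<open>Extended-valued expectations\<close>

text \<open>Conditional expectations given the information are handled through events: an identity
  is stated for \<open>ext_expectation\<close> with respect to \<open>density\<close> by the
  indicator of an information event. One induction over all such events serves both conclusions. The
  whole space at time 0 compares total costs, and letting the event vary identifies the cost-to-go
  through uniqueness of conditional expectations. The induction passes from t + 1 to t because
  information is never lost, so an event of time t is also an event of time t + 1. A further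
  obstacle is that expected costs may be infinite. Equations between differences are kept in the
  subtraction-free form \<open>a + n = p + b\<close> in \<open>ennreal\<close>, where they can be
  integrated, and become differences again only once the subtracted integrals are known to be
  finite. Independence is transported via generated sigma-algebras: the state and the information
  are shown to be measurable with respect to the past noises, without an explicit formula for them
  as functions of the noises.\<close>

definition quasi_integrable :: "'a measure \<Rightarrow> ('a \<Rightarrow> ereal) \<Rightarrow> bool" where
  "quasi_integrable M f \<longleftrightarrow>
     f \<in> borel_measurable M \<and> (\<integral>\<^sup>+\<omega>. e2ennreal (- f \<omega>) \<partial>M) < \<infinity>"

text \<open>The subtraction is moved across the equation so that it survives
  \<open>p = \<infinity>\<close> and can be integrated termwise. The bound makes the negative part
  integrable whenever \<open>n\<close> is.\<close>

lemma e2ennreal_diff: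
  assumes "n < \<infinity>"
  shows "e2ennreal (enn2ereal p - enn2ereal n) + n = p + e2ennreal (- (enn2ereal p - enn2ereal n))"
    and "e2ennreal (- (enn2ereal p - enn2ereal n)) \<le> n"
proof -
  obtain b where b: "n = ennreal b" "0 \<le> b" using assms by (cases n) auto
  show "e2ennreal (enn2ereal p - enn2ereal n) + n = p + e2ennreal (- (enn2ereal p - enn2ereal n))"
  proof (cases p)
    case (real r)
    then show ?thesis
      using b by (cases "r \<le> b")
        (auto simp: e2ennreal_ereal enn2ereal_ennreal ennreal_neg ennreal_plus[symmetric]
          simp del: ennreal_plus)
  qed (use b in \<open>auto simp: e2ennreal_ereal enn2ereal_ennreal enn2ereal_top\<close>)
  show "e2ennreal (- (enn2ereal p - enn2ereal n)) \<le> n"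
    using b by (cases p) (auto simp: e2ennreal_ereal e2ennreal_neg enn2ereal_top enn2ereal_ennreal intro!: ennreal_leI)
qed

lemma enn2ereal_diff_eqI:
  assumes "a + n = p + b" "n < \<infinity>" "b < \<infinity>"
  shows "enn2ereal a - enn2ereal b = enn2ereal p - enn2ereal n"
  using assms by (cases a; cases b; cases p; cases n)
    (auto simp: enn2ereal_ennreal ennreal_plus[symmetric] simp del: ennreal_plus)

text \<open>The functions \<open>p\<close> and \<open>n\<close> may overlap, so they are in general
  not the positive and negative part of their difference. Integrating the identity of
  \<open>e2ennreal_diff\<close> shows that any decomposition with integrable \<open>n\<close>
  computes the expectation.\<close>

lemma ext_expectation_diff:
  assumes [measurable]: "p \<in> borel_measurable M" "n \<in> borel_measurable M"
    and fin: "(\<integral>\<^sup>+\<omega>. n \<omega> \<partial>M) < \<infinity>"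
  shows "ext_expectation M (\<lambda>\<omega>. enn2ereal (p \<omega>) - enn2ereal (n \<omega>)) =
      enn2ereal (\<integral>\<^sup>+\<omega>. p \<omega> \<partial>M) - enn2ereal (\<integral>\<^sup>+\<omega>. n \<omega> \<partial>M)"
    and "quasi_integrable M (\<lambda>\<omega>. enn2ereal (p \<omega>) - enn2ereal (n \<omega>))"
proof -
  let ?d = "\<lambda>\<omega>. enn2ereal (p \<omega>) - enn2ereal (n \<omega>)"
  have ae: "AE \<omega> in M. n \<omega> < \<infinity>"
    using nn_integral_PInf_AE[of n M] fin by (auto simp: top.not_eq_extremum)
  have "(\<integral>\<^sup>+\<omega>. e2ennreal (- ?d \<omega>) \<partial>M) \<le> (\<integral>\<^sup>+\<omega>. n \<omega> \<partial>M)"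
    by (rule nn_integral_mono_AE) (use ae e2ennreal_diff(2) in \<open>auto elim!: eventually_mono\<close>)
  then have neg: "(\<integral>\<^sup>+\<omega>. e2ennreal (- ?d \<omega>) \<partial>M) < \<infinity>"
    using fin by (rule le_less_trans)
  show "quasi_integrable M ?d"
    using neg by (simp add: quasi_integrable_def)
  have "(\<integral>\<^sup>+\<omega>. e2ennreal (?d \<omega>) \<partial>M) + (\<integral>\<^sup>+\<omega>. n \<omega> \<partial>M) = (\<integral>\<^sup>+\<omega>. e2ennreal (?d \<omega>) + n \<omega> \<partial>M)"
    by (rule nn_integral_add[symmetric]) measurable
  also have "\<dots> = (\<integral>\<^sup>+\<omega>. p \<omega> + e2ennreal (- ?d \<omega>) \<partial>M)"
    by (rule nn_integral_cong_AE) (use ae e2ennreal_diff(1) in \<open>auto elim!: eventually_mono\<close>)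
  also have "\<dots> = (\<integral>\<^sup>+\<omega>. p \<omega> \<partial>M) + (\<integral>\<^sup>+\<omega>. e2ennreal (- ?d \<omega>) \<partial>M)"
    by (rule nn_integral_add) measurable
  finally show "ext_expectation M ?d = enn2ereal (\<integral>\<^sup>+\<omega>. p \<omega> \<partial>M) - enn2ereal (\<integral>\<^sup>+\<omega>. n \<omega> \<partial>M)"
    unfolding ext_expectation_def by (rule enn2ereal_diff_eqI) (fact fin neg)+
qed

lemma ext_expectation_cong:
  "(\<And>\<omega>. \<omega> \<in> space M \<Longrightarrow> f \<omega> = h \<omega>) \<Longrightarrow> ext_expectation M f = ext_expectation M h"
  unfolding ext_expectation_def by (simp cong: nn_integral_cong)

lemma ext_expectation_cong_AE:
  assumes "AE \<omega> in M. f \<omega> = h \<omega>"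
  shows "ext_expectation M f = ext_expectation M h"
proof -
  have "(\<integral>\<^sup>+\<omega>. e2ennreal (f \<omega>) \<partial>M) = (\<integral>\<^sup>+\<omega>. e2ennreal (h \<omega>) \<partial>M)"
    "(\<integral>\<^sup>+\<omega>. e2ennreal (- f \<omega>) \<partial>M) = (\<integral>\<^sup>+\<omega>. e2ennreal (- h \<omega>) \<partial>M)"
    by (rule nn_integral_cong_AE, use assms in \<open>auto elim!: eventually_mono\<close>)+
  then show ?thesis by (simp add: ext_expectation_def)
qed

text \<open>Both parts move in the right direction, and subtraction in \<open>ereal\<close> is
  monotone also at \<infinity> - \<infinity>, so the comparison is valid for arbitrary
  functions.\<close>

lemma ext_expectation_mono:
  assumes "\<And>\<omega>. \<omega> \<in> space M \<Longrightarrow> f \<omega> \<le> h \<omega>"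
  shows "ext_expectation M f \<le> ext_expectation M h"
  unfolding ext_expectation_def
  by (intro ereal_minus_mono less_eq_ennreal.rep_eq[THEN iffD1] nn_integral_mono e2ennreal_mono)
     (auto simp: assms)

lemma quasi_integrable_AE:
  assumes "quasi_integrable M f"
  shows "AE \<omega> in M. e2ennreal (- f \<omega>) < \<infinity>"
  using assms nn_integral_PInf_AE[of "\<lambda>\<omega>. e2ennreal (- f \<omega>)" M]
  by (auto simp: quasi_integrable_def top.not_eq_extremum)

lemma enn2ereal_ennreal_max: "enn2ereal (ennreal r) = ereal (max 0 r)"
  by (cases "0 \<le> r") (auto simp: enn2ereal_ennreal ennreal_neg zero_ennreal.rep_eq max_def)

lemma ereal_split: "x = enn2ereal (e2ennreal x) - enn2ereal (e2ennreal (- x))"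
  by (cases x) (auto simp: e2ennreal_ereal enn2ereal_ennreal_max e2ennreal_neg zero_ennreal.rep_eq max_def)

text \<open>Cross sums are nonnegative and can be compared as densities; finite negative parts allow
  such a comparison to be translated back to signed values.\<close>

lemma ereal_eqI_split:
  assumes "e2ennreal x + e2ennreal (- y) = e2ennreal y + e2ennreal (- x)"
    and "e2ennreal (- x) < \<infinity>" "e2ennreal (- y) < \<infinity>"
  shows "x = y"
  using enn2ereal_diff_eqI[OF assms(1,3,2)] ereal_split[of x] ereal_split[of y] by simp

lemma ereal_add_split:
  assumes "e2ennreal (- x) < \<infinity>" "e2ennreal (- y) < \<infinity>"
  shows "x + y = enn2ereal (e2ennreal x + e2ennreal y) - enn2ereal (e2ennreal (- x) + e2ennreal (- y))"
  using assms by (cases x; cases y) (auto simp: e2ennreal_ereal plus_ennreal.rep_eq enn2ereal_ennreal_max max_def)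

text \<open>Because of cancellation, the parts of a sum are not the sums of the parts. Almost
  everywhere the sum is still the difference of the latter, which is all that
  \<open>ext_expectation_diff\<close> asks for.\<close>

lemma
  assumes "quasi_integrable M f" "quasi_integrable M h"
  shows ext_expectation_add:
      "ext_expectation M (\<lambda>\<omega>. f \<omega> + h \<omega>) = ext_expectation M f + ext_expectation M h"
    and quasi_integrable_add: "quasi_integrable M (\<lambda>\<omega>. f \<omega> + h \<omega>)"
proof -
  have [measurable]: "f \<in> borel_measurable M" "h \<in> borel_measurable M"
    and f: "(\<integral>\<^sup>+\<omega>. e2ennreal (- f \<omega>) \<partial>M) < \<infinity>" and h: "(\<integral>\<^sup>+\<omega>. e2ennreal (- h \<omega>) \<partial>M) < \<infinity>"
    using assms by (auto simp: quasi_integrable_def)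
  let ?d = "\<lambda>\<omega>. enn2ereal (e2ennreal (f \<omega>) + e2ennreal (h \<omega>)) -
    enn2ereal (e2ennreal (- f \<omega>) + e2ennreal (- h \<omega>))"
  have ae: "AE \<omega> in M. f \<omega> + h \<omega> = ?d \<omega>"
    using quasi_integrable_AE[OF assms(1)] quasi_integrable_AE[OF assms(2)]
    by eventually_elim (rule ereal_add_split)
  have i: "(\<integral>\<^sup>+\<omega>. e2ennreal (- f \<omega>) + e2ennreal (- h \<omega>) \<partial>M) < \<infinity>"
    using f h by (subst nn_integral_add) auto
  have "(\<integral>\<^sup>+\<omega>. e2ennreal (- (f \<omega> + h \<omega>)) \<partial>M) = (\<integral>\<^sup>+\<omega>. e2ennreal (- ?d \<omega>) \<partial>M)"
    by (rule nn_integral_cong_AE) (use ae in \<open>auto elim!: eventually_mono\<close>)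
  also have "\<dots> < \<infinity>"
    using ext_expectation_diff(2)[OF _ _ i] by (simp add: quasi_integrable_def)
  finally show "quasi_integrable M (\<lambda>\<omega>. f \<omega> + h \<omega>)"
    by (simp add: quasi_integrable_def)
  have "ext_expectation M (\<lambda>\<omega>. f \<omega> + h \<omega>) =
      enn2ereal (\<integral>\<^sup>+\<omega>. e2ennreal (f \<omega>) + e2ennreal (h \<omega>) \<partial>M) -
      enn2ereal (\<integral>\<^sup>+\<omega>. e2ennreal (- f \<omega>) + e2ennreal (- h \<omega>) \<partial>M)"
    unfolding ext_expectation_cong_AE[OF ae] by (rule ext_expectation_diff(1)[OF _ _ i]) measurable
  also have "\<dots> = ext_expectation M f + ext_expectation M h"
    unfolding ext_expectation_def using f h
    by (simp add: nn_integral_add)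
       (cases "\<integral>\<^sup>+\<omega>. e2ennreal (f \<omega>) \<partial>M"; cases "\<integral>\<^sup>+\<omega>. e2ennreal (h \<omega>) \<partial>M";
        cases "\<integral>\<^sup>+\<omega>. e2ennreal (- f \<omega>) \<partial>M"; cases "\<integral>\<^sup>+\<omega>. e2ennreal (- h \<omega>) \<partial>M";
        simp add: plus_ennreal.rep_eq enn2ereal_ennreal)
  finally show "ext_expectation M (\<lambda>\<omega>. f \<omega> + h \<omega>) = ext_expectation M f + ext_expectation M h" .
qed

lemma quasi_integrable_sum:
  assumes "finite I" "\<And>i. i \<in> I \<Longrightarrow> quasi_integrable M (f i)"
  shows "quasi_integrable M (\<lambda>\<omega>. \<Sum>i\<in>I. f i \<omega>)"
  using assms
proof (induction I)
  case empty
  then show ?case by (simp add: quasi_integrable_def)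
next
  case (insert i I)
  then show ?case by (simp add: quasi_integrable_add)
qed

lemma quasi_integrable_cong:
  "(\<And>\<omega>. \<omega> \<in> space M \<Longrightarrow> f \<omega> = h \<omega>) \<Longrightarrow> quasi_integrable M f = quasi_integrable M h"
  unfolding quasi_integrable_def by (simp cong: nn_integral_cong measurable_cong)

section \<open>Restriction to events, disintegration and conditional expectation in extended
  values\<close>

lemma density_indicator_space: "density M (indicator (space M)) = M"
proof -
  have "density M (indicator (space M)) = density M (\<lambda>_. 1)"
    by (rule density_cong) (auto intro!: AE_I2)
  then show ?thesis by (simp add: density_1)
qed

lemma quasi_integrable_density_indicator:
  assumes "quasi_integrable M f" "A \<in> sets M"
  shows "quasi_integrable (density M (indicator A)) f"
proof -
  have [measurable]: "f \<in> borel_measurable M" "A \<in> sets M"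
    using assms by (auto simp: quasi_integrable_def)
  have "(\<integral>\<^sup>+\<omega>. e2ennreal (- f \<omega>) \<partial>density M (indicator A)) \<le> (\<integral>\<^sup>+\<omega>. e2ennreal (- f \<omega>) \<partial>M)"
    by (simp add: nn_integral_density, intro nn_integral_mono) (auto simp: indicator_def)
  then show ?thesis
    using assms by (auto simp: quasi_integrable_def)
qed

text \<open>Tower property for a family of measures \<open>K\<close>. The hypotheses
  \<open>pos\<close> and \<open>neg\<close> treat the two nonnegative parts separately, where
  Tonelli applies; the inner expectation is then a difference of measurable functions whose
  subtrahend is integrable.\<close>

lemma
  assumes "quasi_integrable M f"
    and pos: "(\<integral>\<^sup>+\<omega>. e2ennreal (f \<omega>) \<partial>M) = (\<integral>\<^sup>+\<omega>. (\<integral>\<^sup>+z. e2ennreal (h \<omega> z) \<partial>K \<omega>) \<partial>M)"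
    and neg: "(\<integral>\<^sup>+\<omega>. e2ennreal (- f \<omega>) \<partial>M) = (\<integral>\<^sup>+\<omega>. (\<integral>\<^sup>+z. e2ennreal (- h \<omega> z) \<partial>K \<omega>) \<partial>M)"
    and [measurable]: "(\<lambda>\<omega>. \<integral>\<^sup>+z. e2ennreal (h \<omega> z) \<partial>K \<omega>) \<in> borel_measurable M"
      "(\<lambda>\<omega>. \<integral>\<^sup>+z. e2ennreal (- h \<omega> z) \<partial>K \<omega>) \<in> borel_measurable M"
  shows ext_expectation_disintegrate:
      "ext_expectation M f = ext_expectation M (\<lambda>\<omega>. ext_expectation (K \<omega>) (h \<omega>))"
    and quasi_integrable_disintegrate:
      "quasi_integrable M (\<lambda>\<omega>. ext_expectation (K \<omega>) (h \<omega>))"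
proof -
  have fin: "(\<integral>\<^sup>+\<omega>. (\<integral>\<^sup>+z. e2ennreal (- h \<omega> z) \<partial>K \<omega>) \<partial>M) < \<infinity>"
    using assms(1) by (simp add: quasi_integrable_def neg)
  show "ext_expectation M f = ext_expectation M (\<lambda>\<omega>. ext_expectation (K \<omega>) (h \<omega>))"
    unfolding ext_expectation_def[of "K _"] ext_expectation_diff(1)[OF assms(4,5) fin]
    by (simp add: ext_expectation_def pos neg)
  show "quasi_integrable M (\<lambda>\<omega>. ext_expectation (K \<omega>) (h \<omega>))"
    unfolding ext_expectation_def[of "K _"] by (rule ext_expectation_diff(2)[OF assms(4,5) fin])
qed

text \<open>The characterizing identity of \<open>nn_cond_exp\<close> holds for each part. The
  conditional negative part has the same finite integral as the negative part, which permits the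
  subtraction.\<close>

lemma (in sigma_finite_subalgebra)
  assumes f: "quasi_integrable M f"
  shows ext_expectation_ext_cond_exp: "A \<in> sets F \<Longrightarrow>
      ext_expectation (density M (indicator A)) (ext_cond_exp M F f) =
      ext_expectation (density M (indicator A)) f"
    and quasi_integrable_ext_cond_exp: "quasi_integrable M (ext_cond_exp M F f)"
proof -
  have [measurable]: "f \<in> borel_measurable M"
    using f by (simp add: quasi_integrable_def)
  have M: "nn_cond_exp M F h \<in> borel_measurable M" for h
    by (rule measurable_from_subalg[OF subalg borel_measurable_nn_cond_exp])
  have eq: "(\<integral>\<^sup>+\<omega>. nn_cond_exp M F h \<omega> \<partial>density M (indicator A)) = (\<integral>\<^sup>+\<omega>. h \<omega> \<partial>density M (indicator A))"
    if A: "A \<in> sets F" and [measurable]: "h \<in> borel_measurable M" for h A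
  proof -
    have [measurable]: "A \<in> sets M" using A subalg by (auto simp: subalgebra_def)
    show ?thesis
      using nn_cond_exp_intg[of "indicator A" h] A by (simp add: nn_integral_density M)
  qed
  have fin: "(\<integral>\<^sup>+\<omega>. nn_cond_exp M F (\<lambda>\<omega>. e2ennreal (- f \<omega>)) \<omega> \<partial>density M (indicator A)) < \<infinity>"
    if "A \<in> sets F" for A
    using quasi_integrable_density_indicator[OF f, of A] that subalg
    by (simp add: eq quasi_integrable_def subalgebra_def subset_eq)
  show "ext_expectation (density M (indicator A)) (ext_cond_exp M F f) =
      ext_expectation (density M (indicator A)) f" if "A \<in> sets F"
    unfolding ext_cond_exp_def[abs_def]
    by (subst ext_expectation_diff(1)) (use that fin[OF that] in \<open>auto simp: M eq ext_expectation_def\<close>)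
  have "(\<integral>\<^sup>+\<omega>. nn_cond_exp M F (\<lambda>\<omega>. e2ennreal (- f \<omega>)) \<omega> \<partial>M) < \<infinity>"
    using nn_cond_exp_intg[of "\<lambda>_. 1" "\<lambda>\<omega>. e2ennreal (- f \<omega>)"] f by (simp add: quasi_integrable_def)
  then show "quasi_integrable M (ext_cond_exp M F f)"
    unfolding ext_cond_exp_def[abs_def] by (intro ext_expectation_diff(2)) (auto simp: M)
qed

text \<open>Moving the negative parts across leaves two nonnegative functions with equal integrals
  over every event of \<open>F\<close>, hence two densities of one measure on the restricted space.
  Sigma-finiteness there makes densities unique almost everywhere, even where they are
  infinite.\<close>

lemma (in sigma_finite_subalgebra) AE_eqI_ext_expectation:
  assumes f: "quasi_integrable M f" "f \<in> borel_measurable F"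
    and h: "quasi_integrable M h" "h \<in> borel_measurable F"
    and eq: "\<And>A. A \<in> sets F \<Longrightarrow> ext_expectation (density M (indicator A)) f =
      ext_expectation (density M (indicator A)) h"
  shows "AE \<omega> in M. f \<omega> = h \<omega>"
proof -
  interpret R: sigma_finite_measure "restr_to_subalg M F" by (rule sigma_fin_subalg)
  note [measurable] = f(2) h(2)
  have [measurable]: "f \<in> borel_measurable M" "h \<in> borel_measurable M"
    using f h by (auto simp: quasi_integrable_def)
  let ?F = "\<lambda>\<omega>. e2ennreal (f \<omega>) + e2ennreal (- h \<omega>)"
  let ?H = "\<lambda>\<omega>. e2ennreal (h \<omega>) + e2ennreal (- f \<omega>)"
  have FH: "?F \<in> borel_measurable F" "?H \<in> borel_measurable F" by measurable
  have FHr: "?F \<in> borel_measurable (restr_to_subalg M F)" "?H \<in> borel_measurable (restr_to_subalg M F)"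
    using FH subalg by (auto intro: measurable_in_subalg)
  have int: "(\<integral>\<^sup>+\<omega>. ?F \<omega> * indicator A \<omega> \<partial>M) = (\<integral>\<^sup>+\<omega>. ?H \<omega> * indicator A \<omega> \<partial>M)"
    if A: "A \<in> sets F" for A
  proof -
    have [measurable]: "A \<in> sets M" using A subalg by (auto simp: subalgebra_def)
    let ?M = "density M (indicator A)"
    have "(\<integral>\<^sup>+\<omega>. e2ennreal (- f \<omega>) \<partial>?M) < \<infinity>" "(\<integral>\<^sup>+\<omega>. e2ennreal (- h \<omega>) \<partial>?M) < \<infinity>"
      using quasi_integrable_density_indicator[OF f(1)] quasi_integrable_density_indicator[OF h(1)]
      by (auto simp: quasi_integrable_def)
    \<comment> \<open>The subtracted integrals are finite on both sides, so the equation between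
      differences can be rearranged into sums.\<close>
    with eq[OF A] have "(\<integral>\<^sup>+\<omega>. e2ennreal (f \<omega>) \<partial>?M) + (\<integral>\<^sup>+\<omega>. e2ennreal (- h \<omega>) \<partial>?M) =
        (\<integral>\<^sup>+\<omega>. e2ennreal (h \<omega>) \<partial>?M) + (\<integral>\<^sup>+\<omega>. e2ennreal (- f \<omega>) \<partial>?M)"
      unfolding ext_expectation_def
      by (cases "\<integral>\<^sup>+\<omega>. e2ennreal (f \<omega>) \<partial>?M"; cases "\<integral>\<^sup>+\<omega>. e2ennreal (h \<omega>) \<partial>?M";
        cases "\<integral>\<^sup>+\<omega>. e2ennreal (- f \<omega>) \<partial>?M"; cases "\<integral>\<^sup>+\<omega>. e2ennreal (- h \<omega>) \<partial>?M")
        (auto simp: enn2ereal_ennreal ennreal_plus[symmetric] simp del: ennreal_plus)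
    then have "(\<integral>\<^sup>+\<omega>. ?F \<omega> \<partial>?M) = (\<integral>\<^sup>+\<omega>. ?H \<omega> \<partial>?M)"
      by (simp add: nn_integral_add)
    then show ?thesis
      by (simp add: nn_integral_density mult.commute)
  qed
  have "density (restr_to_subalg M F) ?F = density (restr_to_subalg M F) ?H"
  proof (rule measure_eqI)
    fix A assume "A \<in> sets (density (restr_to_subalg M F) ?F)"
    then have A: "A \<in> sets F" using subalg by (simp add: sets_restr_to_subalg)
    have "(\<integral>\<^sup>+\<omega>. ?F \<omega> * indicator A \<omega> \<partial>restr_to_subalg M F) =
      (\<integral>\<^sup>+\<omega>. ?H \<omega> * indicator A \<omega> \<partial>restr_to_subalg M F)"
      using int[OF A] A FH by (subst (1 2) nn_integral_subalgebra2[OF subalg]) auto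
    then show "emeasure (density (restr_to_subalg M F) ?F) A =
        emeasure (density (restr_to_subalg M F) ?H) A"
      using A subalg FHr by (simp add: emeasure_density sets_restr_to_subalg)
  qed simp
  then have "AE \<omega> in restr_to_subalg M F. ?F \<omega> = ?H \<omega>"
    by (rule R.density_unique[OF FHr])
  then have "AE \<omega> in M. ?F \<omega> = ?H \<omega>"
    by (rule AE_restr_to_subalg[OF subalg])
  with quasi_integrable_AE[OF f(1)] quasi_integrable_AE[OF h(1)] show ?thesis
    by eventually_elim (rule ereal_eqI_split)
qed

section \<open>Independence of random variables of different types\<close>

context prob_space
begin

text \<open>The library's \<open>indep_var\<close> requires both variables to have the same type.\<close>

definition indep_pair :: "'b measure \<Rightarrow> ('a \<Rightarrow> 'b) \<Rightarrow> 'c measure \<Rightarrow> ('a \<Rightarrow> 'c) \<Rightarrow> bool" where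
  "indep_pair MA A MB B \<longleftrightarrow> A \<in> M \<rightarrow>\<^sub>M MA \<and> B \<in> M \<rightarrow>\<^sub>M MB \<and>
     distr M (MA \<Otimes>\<^sub>M MB) (\<lambda>\<omega>. (A \<omega>, B \<omega>)) = distr M MA A \<Otimes>\<^sub>M distr M MB B"

text \<open>The product law feeds Fubini, whereas independence of generated sigma-algebras is how
  the model states its assumptions and what passes easily to derived variables. The two agree
  because rectangles determine a product law.\<close>

lemma indep_pair_iff_indep_set:
  "indep_pair MA A MB B \<longleftrightarrow> A \<in> M \<rightarrow>\<^sub>M MA \<and> B \<in> M \<rightarrow>\<^sub>M MB \<and>
    indep_set (sets (vimage_algebra (space M) A MA)) (sets (vimage_algebra (space M) B MB))"
  unfolding indep_pair_def
proof (intro conj_cong refl)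
  assume A [measurable]: "A \<in> M \<rightarrow>\<^sub>M MA" and B [measurable]: "B \<in> M \<rightarrow>\<^sub>M MB"
  interpret A: prob_space "distr M MA A" by (rule prob_space_distr) measurable
  interpret B: prob_space "distr M MB B" by (rule prob_space_distr) measurable
  have maps: "A \<in> space M \<rightarrow> space MA" "B \<in> space M \<rightarrow> space MB"
    using measurable_space[OF A] measurable_space[OF B] by auto
  let ?J = "distr M (MA \<Otimes>\<^sub>M MB) (\<lambda>\<omega>. (A \<omega>, B \<omega>))"
  have J: "emeasure ?J (a \<times> b) = prob ((A -` a \<inter> space M) \<inter> (B -` b \<inter> space M))"
    if "a \<in> sets MA" "b \<in> sets MB" for a b
  proof -
    have "(\<lambda>\<omega>. (A \<omega>, B \<omega>)) -` (a \<times> b) \<inter> space M = (A -` a \<inter> space M) \<inter> (B -` b \<inter> space M)"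
      by auto
    then show ?thesis using that by (simp add: emeasure_distr emeasure_eq_measure)
  qed
  have AB: "emeasure (distr M MA A) a * emeasure (distr M MB B) b =
      ennreal (prob (A -` a \<inter> space M) * prob (B -` b \<inter> space M))"
    if "a \<in> sets MA" "b \<in> sets MB" for a b
    using that by (simp add: emeasure_distr emeasure_eq_measure ennreal_mult)
  show "?J = distr M MA A \<Otimes>\<^sub>M distr M MB B \<longleftrightarrow>
      indep_set (sets (vimage_algebra (space M) A MA)) (sets (vimage_algebra (space M) B MB))"
  proof
    assume eq: "?J = distr M MA A \<Otimes>\<^sub>M distr M MB B"
    show "indep_set (sets (vimage_algebra (space M) A MA)) (sets (vimage_algebra (space M) B MB))"
    proof (rule indep_setI)
      fix x y assume "x \<in> sets (vimage_algebra (space M) A MA)" "y \<in> sets (vimage_algebra (space M) B MB)"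
      then obtain a b where xy: "x = A -` a \<inter> space M" "y = B -` b \<inter> space M"
        and ab: "a \<in> sets MA" "b \<in> sets MB"
        using maps by (auto simp: sets_vimage_algebra2)
      have "ennreal (prob (x \<inter> y)) = ennreal (prob x * prob y)"
        using J[OF ab] AB[OF ab] ab by (simp add: eq B.emeasure_pair_measure_Times xy)
      then show "prob (x \<inter> y) = prob x * prob y" by simp
    qed (use maps in \<open>auto simp: sets_vimage_algebra2\<close>)
  next
    assume ind: "indep_set (sets (vimage_algebra (space M) A MA)) (sets (vimage_algebra (space M) B MB))"
    show "?J = distr M MA A \<Otimes>\<^sub>M distr M MB B"
    proof (rule pair_measure_eqI[symmetric])
      fix a b assume "a \<in> sets (distr M MA A)" "b \<in> sets (distr M MB B)"
      then have ab: "a \<in> sets MA" "b \<in> sets MB" by auto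
      have "prob ((A -` a \<inter> space M) \<inter> (B -` b \<inter> space M)) =
          prob (A -` a \<inter> space M) * prob (B -` b \<inter> space M)"
        using ab by (intro indep_setD[OF ind] in_vimage_algebra)
      then show "emeasure (distr M MA A) a * emeasure (distr M MB B) b = emeasure ?J (a \<times> b)"
        by (simp add: AB[OF ab] J[OF ab])
    qed (auto cong: sets_pair_measure_cong intro: A.sigma_finite_measure B.sigma_finite_measure)
  qed
qed

lemma indep_pair_sym:
  assumes "indep_pair MA A MB B"
  shows "indep_pair MB B MA A"
proof -
  have "indep_set (sets (vimage_algebra (space M) A MA)) (sets (vimage_algebra (space M) B MB))"
    using assms by (simp add: indep_pair_iff_indep_set)
  then have "indep_set (sets (vimage_algebra (space M) B MB)) (sets (vimage_algebra (space M) A MA))"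
    unfolding indep_sets2_eq by (metis Int_commute mult.commute)
  then show ?thesis using assms by (simp add: indep_pair_iff_indep_set)
qed

text \<open>Measurability with respect to the sigma-algebra generated by \<open>B\<close> replaces a
  representation of \<open>C\<close> as a function of \<open>B\<close>. It is in this sense only
  that trajectories are shown to depend on the noises.\<close>

lemma indep_pair_measurable_vimage:
  assumes ind: "indep_pair MA A MB B"
    and C: "C \<in> vimage_algebra (space M) B MB \<rightarrow>\<^sub>M MC"
  shows "indep_pair MA A MC C"
proof -
  have AB: "A \<in> M \<rightarrow>\<^sub>M MA" "B \<in> M \<rightarrow>\<^sub>M MB"
    and i: "indep_set (sets (vimage_algebra (space M) A MA)) (sets (vimage_algebra (space M) B MB))"
    using ind by (auto simp: indep_pair_iff_indep_set)
  have "sets (vimage_algebra (space M) B MB) \<subseteq> sets M"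
    using AB(2) by (auto simp: sets_vimage_algebra intro!: sets.sigma_sets_subset)
  then have "vimage_algebra (space M) B MB \<rightarrow>\<^sub>M MC \<subseteq> M \<rightarrow>\<^sub>M MC"
    by (intro measurable_mono) auto
  then have "C \<in> M \<rightarrow>\<^sub>M MC"
    using C by blast
  moreover have "{C -` E \<inter> space M | E. E \<in> sets MC} \<subseteq> sets (vimage_algebra (space M) B MB)"
    using measurable_sets[OF C] by auto
  then have "sets (vimage_algebra (space M) C MC) \<subseteq> sets (vimage_algebra (space M) B MB)"
    using sets.sigma_sets_subset[of _ "vimage_algebra (space M) B MB"]
    unfolding sets_vimage_algebra[of _ C] by simp
  then have "indep_set (sets (vimage_algebra (space M) A MA)) (sets (vimage_algebra (space M) C MC))"
    using i unfolding indep_sets2_eq by blast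
  ultimately show ?thesis using AB by (simp add: indep_pair_iff_indep_set)
qed

lemma indep_pair_compose_right:
  assumes ind: "indep_pair MA A MB B" and g: "g \<in> MB \<rightarrow>\<^sub>M NB"
  shows "indep_pair MA A NB (\<lambda>\<omega>. g (B \<omega>))"
  using ind
proof (rule indep_pair_measurable_vimage)
  have "B \<in> vimage_algebra (space M) B MB \<rightarrow>\<^sub>M MB"
    using ind measurable_space[of B M MB] by (intro measurable_vimage_algebra1) (auto simp: indep_pair_def)
  then show "(\<lambda>\<omega>. g (B \<omega>)) \<in> vimage_algebra (space M) B MB \<rightarrow>\<^sub>M NB"
    using g by (rule measurable_compose)
qed

lemma indep_pair_compose:
  assumes "indep_pair MA A MB B" "f \<in> MA \<rightarrow>\<^sub>M NA" "g \<in> MB \<rightarrow>\<^sub>M NB"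
  shows "indep_pair NA (\<lambda>\<omega>. f (A \<omega>)) NB (\<lambda>\<omega>. g (B \<omega>))"
  by (rule indep_pair_compose_right[OF indep_pair_sym[OF
      indep_pair_compose_right[OF indep_pair_sym[OF assms(1)] assms(2)]] assms(3)])

text \<open>The two assumptions make the law of the triple a product of three factors, which Fubini
  allows to reorder. This converts independence between groups of noises into independence of one
  noise from everything before it.\<close>

lemma indep_pair_rotate:
  assumes A_BC: "indep_pair MA A (MB \<Otimes>\<^sub>M MC) (\<lambda>\<omega>. (B \<omega>, C \<omega>))"
    and B_C: "indep_pair MB B MC C"
  shows "indep_pair MB B (MA \<Otimes>\<^sub>M MC) (\<lambda>\<omega>. (A \<omega>, C \<omega>))"
proof -
  have [measurable]: "A \<in> M \<rightarrow>\<^sub>M MA" "B \<in> M \<rightarrow>\<^sub>M MB" "C \<in> M \<rightarrow>\<^sub>M MC"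
    using A_BC B_C by (auto simp: indep_pair_def)
  have A_C: "indep_pair MA A MC C"
    using indep_pair_compose[OF A_BC, of "\<lambda>a. a" MA snd MC] by simp
  let ?A = "distr M MA A" and ?B = "distr M MB B" and ?C = "distr M MC C"
  interpret A: prob_space ?A by (rule prob_space_distr) measurable
  interpret B: prob_space ?B by (rule prob_space_distr) measurable
  interpret C: prob_space ?C by (rule prob_space_distr) measurable
  interpret BA: pair_sigma_finite ?B ?A ..
  interpret BC: pair_prob_space ?B ?C ..
  interpret AC: pair_prob_space ?A ?C ..
  have BC: "distr M (MB \<Otimes>\<^sub>M MC) (\<lambda>\<omega>. (B \<omega>, C \<omega>)) = ?B \<Otimes>\<^sub>M ?C"
    and AC: "distr M (MA \<Otimes>\<^sub>M MC) (\<lambda>\<omega>. (A \<omega>, C \<omega>)) = ?A \<Otimes>\<^sub>M ?C"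
    using B_C A_C by (simp_all add: indep_pair_def)
  have ABC: "distr M (MA \<Otimes>\<^sub>M (MB \<Otimes>\<^sub>M MC)) (\<lambda>\<omega>. (A \<omega>, B \<omega>, C \<omega>)) = ?A \<Otimes>\<^sub>M (?B \<Otimes>\<^sub>M ?C)"
    using A_BC by (simp add: indep_pair_def BC)
  have "distr M (MB \<Otimes>\<^sub>M (MA \<Otimes>\<^sub>M MC)) (\<lambda>\<omega>. (B \<omega>, A \<omega>, C \<omega>)) = ?B \<Otimes>\<^sub>M (?A \<Otimes>\<^sub>M ?C)"
  proof (rule measure_eqI)
    fix E assume "E \<in> sets (distr M (MB \<Otimes>\<^sub>M (MA \<Otimes>\<^sub>M MC)) (\<lambda>\<omega>. (B \<omega>, A \<omega>, C \<omega>)))"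
    then have [measurable]: "E \<in> sets (MB \<Otimes>\<^sub>M (MA \<Otimes>\<^sub>M MC))" by simp
    have "emeasure (distr M (MB \<Otimes>\<^sub>M (MA \<Otimes>\<^sub>M MC)) (\<lambda>\<omega>. (B \<omega>, A \<omega>, C \<omega>))) E =
        (\<integral>\<^sup>+x. indicator E x \<partial>distr M (MB \<Otimes>\<^sub>M (MA \<Otimes>\<^sub>M MC)) (\<lambda>\<omega>. (B \<omega>, A \<omega>, C \<omega>)))"
      by simp
    also have "\<dots> = (\<integral>\<^sup>+\<omega>. indicator E (B \<omega>, A \<omega>, C \<omega>) \<partial>M)"
      by (subst nn_integral_distr) auto
    also have "\<dots> = (\<integral>\<^sup>+x. indicator E (fst (snd x), fst x, snd (snd x)) \<partial>(?A \<Otimes>\<^sub>M (?B \<Otimes>\<^sub>M ?C)))"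
      unfolding ABC[symmetric] by (subst nn_integral_distr) auto
    also have "\<dots> = (\<integral>\<^sup>+a. (\<integral>\<^sup>+x. indicator E (fst x, a, snd x) \<partial>(?B \<Otimes>\<^sub>M ?C)) \<partial>?A)"
      by (subst BC.nn_integral_fst[symmetric]) auto
    also have "\<dots> = (\<integral>\<^sup>+a. (\<integral>\<^sup>+b. (\<integral>\<^sup>+c. indicator E (b, a, c) \<partial>?C) \<partial>?B) \<partial>?A)"
      by (intro nn_integral_cong, subst C.nn_integral_fst[symmetric]) auto
    also have "\<dots> = (\<integral>\<^sup>+b. (\<integral>\<^sup>+a. (\<integral>\<^sup>+c. indicator E (b, a, c) \<partial>?C) \<partial>?A) \<partial>?B)"
      by (rule BA.Fubini') measurable
    also have "\<dots> = (\<integral>\<^sup>+b. (\<integral>\<^sup>+x. indicator E (b, x) \<partial>(?A \<Otimes>\<^sub>M ?C)) \<partial>?B)"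
      by (intro nn_integral_cong, subst C.nn_integral_fst[symmetric]) auto
    also have "\<dots> = (\<integral>\<^sup>+x. indicator E x \<partial>(?B \<Otimes>\<^sub>M (?A \<Otimes>\<^sub>M ?C)))"
      by (subst AC.nn_integral_fst[symmetric]) auto
    finally show "emeasure (distr M (MB \<Otimes>\<^sub>M (MA \<Otimes>\<^sub>M MC)) (\<lambda>\<omega>. (B \<omega>, A \<omega>, C \<omega>))) E =
        emeasure (?B \<Otimes>\<^sub>M (?A \<Otimes>\<^sub>M ?C)) E"
      by simp
  qed (simp cong: sets_pair_measure_cong)
  then show ?thesis by (simp add: indep_pair_def AC)
qed

text \<open>Freezing: under the product law, \<open>A\<close> is integrated out while
  \<open>B\<close> is held fixed. The inner integral runs over a second copy of the sample space, so
  that a distribution known for each fixed value of \<open>B\<close> can be inserted.\<close>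

lemma nn_integral_indep_pair:
  assumes ind: "indep_pair MA A MB B"
    and [measurable]: "(\<lambda>(a, b). f a b) \<in> borel_measurable (MA \<Otimes>\<^sub>M MB)"
  shows "(\<integral>\<^sup>+\<omega>. f (A \<omega>) (B \<omega>) \<partial>M) = (\<integral>\<^sup>+\<omega>. (\<integral>\<^sup>+\<omega>'. f (A \<omega>') (B \<omega>) \<partial>M) \<partial>M)"
proof -
  have [measurable]: "A \<in> M \<rightarrow>\<^sub>M MA" "B \<in> M \<rightarrow>\<^sub>M MB"
    and d: "distr M (MA \<Otimes>\<^sub>M MB) (\<lambda>\<omega>. (A \<omega>, B \<omega>)) = distr M MA A \<Otimes>\<^sub>M distr M MB B"
    using ind by (auto simp: indep_pair_def)
  interpret A: prob_space "distr M MA A" by (rule prob_space_distr) measurable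
  interpret B: prob_space "distr M MB B" by (rule prob_space_distr) measurable
  interpret AB: pair_sigma_finite "distr M MA A" "distr M MB B" ..
  have "(\<integral>\<^sup>+\<omega>. f (A \<omega>) (B \<omega>) \<partial>M) =
      (\<integral>\<^sup>+x. f (fst x) (snd x) \<partial>distr M (MA \<Otimes>\<^sub>M MB) (\<lambda>\<omega>. (A \<omega>, B \<omega>)))"
    by (subst nn_integral_distr) auto
  also have "\<dots> = (\<integral>\<^sup>+b. (\<integral>\<^sup>+a. f a b \<partial>distr M MA A) \<partial>distr M MB B)"
    unfolding d by (subst AB.nn_integral_snd[symmetric]) auto
  also have "\<dots> = (\<integral>\<^sup>+\<omega>. (\<integral>\<^sup>+a. f a (B \<omega>) \<partial>distr M MA A) \<partial>M)"
    by (subst nn_integral_distr) measurable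
  also have "\<dots> = (\<integral>\<^sup>+\<omega>. (\<integral>\<^sup>+\<omega>'. f (A \<omega>') (B \<omega>) \<partial>M) \<partial>M)"
    by (intro nn_integral_cong) (auto simp: nn_integral_distr)
  finally show ?thesis .
qed

text \<open>The definition of \<open>conditional_density\<close> tests rectangles only. These are
  stable under intersection and the law of \<open>(C, X)\<close> is finite, so they determine it: it
  has density \<open>p\<close> with respect to the product of the law of \<open>C\<close> with
  \<open>N\<close>.\<close>

lemma nn_integral_conditional_density:
  assumes cd: "conditional_density M L C N X p"
    and N: "sigma_finite_measure N"
    and [measurable]: "(\<lambda>(c, x). f c x) \<in> borel_measurable (L \<Otimes>\<^sub>M N)"
  shows "(\<integral>\<^sup>+\<omega>. f (C \<omega>) (X \<omega>) \<partial>M) = (\<integral>\<^sup>+\<omega>. (\<integral>\<^sup>+x. p (C \<omega>) x * f (C \<omega>) x \<partial>N) \<partial>M)"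
proof -
  have [measurable]: "C \<in> M \<rightarrow>\<^sub>M L" "X \<in> M \<rightarrow>\<^sub>M N" "(\<lambda>(c, x). p c x) \<in> borel_measurable (L \<Otimes>\<^sub>M N)"
    and eq: "\<And>A B. A \<in> sets L \<Longrightarrow> B \<in> sets N \<Longrightarrow> emeasure M {\<omega> \<in> space M. C \<omega> \<in> A \<and> X \<omega> \<in> B} =
        (\<integral>\<^sup>+\<omega>. indicator A (C \<omega>) * (\<integral>\<^sup>+x. indicator B x * p (C \<omega>) x \<partial>N) \<partial>M)"
    using cd by (auto simp: conditional_density_def)
  interpret N: sigma_finite_measure N by fact
  interpret C: prob_space "distr M L C" by (rule prob_space_distr) measurable
  let ?J = "distr M (L \<Otimes>\<^sub>M N) (\<lambda>\<omega>. (C \<omega>, X \<omega>))"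
  let ?D = "density (distr M L C \<Otimes>\<^sub>M N) (\<lambda>(c, x). p c x)"
  interpret J: prob_space ?J by (rule prob_space_distr) measurable
  let ?E = "{A \<times> B | A B. A \<in> sets L \<and> B \<in> sets N}"
  have "?J = ?D"
  proof (rule measure_eqI_generator_eq[where E = ?E and \<Omega> = "space L \<times> space N" and A = "\<lambda>_. space L \<times> space N"])
    show "Int_stable ?E" by (rule Int_stable_pair_measure_generator)
    show "?E \<subseteq> Pow (space L \<times> space N)" by (rule pair_measure_closed)
    show "sets ?J = sigma_sets (space L \<times> space N) ?E" "sets ?D = sigma_sets (space L \<times> space N) ?E"
      by (simp_all add: sets_pair_measure)
    show "range (\<lambda>_. space L \<times> space N) \<subseteq> ?E" by auto
    show "emeasure ?J (space L \<times> space N) \<noteq> \<infinity>" for i :: nat by simp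
    fix Z assume "Z \<in> ?E"
    then obtain A B where Z: "Z = A \<times> B" and [measurable]: "A \<in> sets L" "B \<in> sets N" by auto
    have "emeasure ?J Z = emeasure M {\<omega> \<in> space M. C \<omega> \<in> A \<and> X \<omega> \<in> B}"
      unfolding Z by (subst emeasure_distr) (auto intro!: arg_cong[where f = "emeasure M"])
    also have "\<dots> = (\<integral>\<^sup>+c. indicator A c * (\<integral>\<^sup>+x. indicator B x * p c x \<partial>N) \<partial>distr M L C)"
      unfolding eq[OF \<open>A \<in> sets L\<close> \<open>B \<in> sets N\<close>] by (subst nn_integral_distr) measurable
    also have "\<dots> = (\<integral>\<^sup>+c. (\<integral>\<^sup>+x. p c x * indicator Z (c, x) \<partial>N) \<partial>distr M L C)"
      by (intro nn_integral_cong)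
         (auto simp: Z indicator_times nn_integral_cmult[symmetric] ac_simps intro!: nn_integral_cong)
    also have "\<dots> = emeasure ?D Z"
      unfolding Z by (subst emeasure_density) (auto simp: N.nn_integral_fst[symmetric])
    finally show "emeasure ?J Z = emeasure ?D Z" .
  qed simp
  then have "(\<integral>\<^sup>+z. f (fst z) (snd z) \<partial>?J) = (\<integral>\<^sup>+z. f (fst z) (snd z) \<partial>?D)" by simp
  also have "\<dots> = (\<integral>\<^sup>+c. (\<integral>\<^sup>+x. p c x * f c x \<partial>N) \<partial>distr M L C)"
    by (subst nn_integral_density) (auto simp: N.nn_integral_fst[symmetric])
  also have "\<dots> = (\<integral>\<^sup>+\<omega>. (\<integral>\<^sup>+x. p (C \<omega>) x * f (C \<omega>) x \<partial>N) \<partial>M)"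
    by (subst nn_integral_distr) measurable
  finally show ?thesis
    by (subst (asm) nn_integral_distr) auto
qed
end

section \<open>Measurability of the information process\<close>

definition joint_observation ::
    "('o, 'x, 'u, 'y, 'w, 'z) system \<Rightarrow> ('u, 'y) strategy \<Rightarrow> nat \<Rightarrow> 'o \<Rightarrow> nat \<Rightarrow> 'y" where
  "joint_observation S g t \<omega> = observe S t (state S g t \<omega>) \<omega>"

text \<open>Together with \<open>decision_history\<close> an inverse of \<open>info\<close> on the
  covered times: shared and private parts hold disjoint ranges of times, so every past entry is
  found in exactly one of them.\<close>

definition observation_history ::
    "('o, 'x, 'u, 'y, 'w, 'z) system \<Rightarrow> nat \<Rightarrow> ('u, 'y) info \<Rightarrow> nat \<Rightarrow> nat \<Rightarrow> 'y" where
  "observation_history S t i s =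
     (if s + delay S \<le> t then fst (snd i) s else (\<lambda>k\<in>{1..members S}. fst (fst i k) s))"

definition decision_history ::
    "('o, 'x, 'u, 'y, 'w, 'z) system \<Rightarrow> nat \<Rightarrow> ('u, 'y) info \<Rightarrow> nat \<Rightarrow> nat \<Rightarrow> 'u" where
  "decision_history S t i s =
     (if s + delay S \<le> t then snd (snd i) s else (\<lambda>k\<in>{1..members S}. snd (fst i k) s))"

text \<open>The update clause for the information state speaks of histories, not of an information.
  Passing through the recovered histories gives a jointly measurable map of the old information, the
  new observation and the new decision.\<close>

definition extend_info ::
    "('o, 'x, 'u, 'y, 'w, 'z) system \<Rightarrow> nat \<Rightarrow> ('u, 'y) info \<Rightarrow> (nat \<Rightarrow> 'y) \<Rightarrow> (nat \<Rightarrow> 'u)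
      \<Rightarrow> ('u, 'y) info" where
  "extend_info S t i y a =
     info S (Suc t) ((observation_history S t i)(Suc t := y)) ((decision_history S t i)(t := a))"

text \<open>Exhibits the information at time t as a measurable function of that at time t + 1, so
  that the generated sigma-algebras increase with time.\<close>

definition truncate_info ::
    "('o, 'x, 'u, 'y, 'w, 'z) system \<Rightarrow> nat \<Rightarrow> ('u, 'y) info \<Rightarrow> ('u, 'y) info" where
  "truncate_info S t i =
     info S t (observation_history S (Suc t) i) (decision_history S (Suc t) i)"

context delayed_sharing
begin

text \<open>A delay of at least 1 keeps the shared decisions strictly in the past:
  \<open>s + delay S \<le> t\<close> implies \<open>s < t\<close>.\<close>

lemma info_cong:
  assumes "\<And>s. s \<le> t \<Longrightarrow> y s = y' s" "\<And>s. s < t \<Longrightarrow> u s = u' s"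
  shows "info S t y u = info S t y' u'"
  using assms delay_ge_1 by (auto simp: info_def fun_eq_iff restrict_def)

lemma state_0: "state S g 0 = initial_state S"
  by (auto simp: state_def Let_def)

lemma state_Suc:
  "state S g (Suc t) \<omega> = dynamics S t (state S g t \<omega>) (decision S g t \<omega>) (state_noise S t \<omega>)"
  by (simp add: state_def decision_def information_def Let_def split: prod.split)

lemma trajectory_eq:
  "trajectory S g \<omega> t = (state S g t \<omega>,
     \<lambda>s. if s \<le> t then joint_observation S g s \<omega> else undefined,
     \<lambda>s. if s < t then decision S g s \<omega> else undefined)"
proof (induction t)
  case 0
  then show ?case
    by (auto simp: Let_def state_0 joint_observation_def)
next
  case (Suc t)
  have d: "decision S g t \<omega> = g t (info S t (\<lambda>s. if s \<le> t then joint_observation S g s \<omega> else undefined)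
      (\<lambda>s. if s < t then decision S g s \<omega> else undefined))"
    by (simp add: decision_def information_def Suc)
  show ?case
    by (auto simp: Suc Let_def d[symmetric] state_Suc[symmetric] joint_observation_def[symmetric])
qed

lemma information_eq:
  "information S g t \<omega> = info S t (\<lambda>s. joint_observation S g s \<omega>) (\<lambda>s. decision S g s \<omega>)"
  by (auto simp: information_def trajectory_eq intro!: info_cong)

lemma measurable_info:
  assumes y: "\<And>s. s \<le> t \<Longrightarrow> y s \<in> N \<rightarrow>\<^sub>M joint_obs_space S"
    and u: "\<And>s. s < t \<Longrightarrow> u s \<in> N \<rightarrow>\<^sub>M joint_decision_space S s"
  shows "(\<lambda>\<omega>. info S t (\<lambda>s. y s \<omega>) (\<lambda>s. u s \<omega>)) \<in> N \<rightarrow>\<^sub>M info_space S t"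
proof -
  have yk: "(\<lambda>\<omega>. y s \<omega> k) \<in> N \<rightarrow>\<^sub>M obs_space S k" if "s \<le> t" "k \<in> {1..members S}" for s k
    using measurable_compose[OF y[unfolded joint_obs_space_def] measurable_component_singleton] that
    by auto
  have uk: "(\<lambda>\<omega>. u s \<omega> k) \<in> N \<rightarrow>\<^sub>M decision_space S s k" if "s < t" "k \<in> {1..members S}" for s k
    using measurable_compose[OF u[unfolded joint_decision_space_def] measurable_component_singleton] that
    by auto
  show ?thesis
    unfolding info_def info_space_def private_space_def shared_space_def
    using delay_ge_1
    by (intro measurable_Pair measurable_restrict y u yk uk) auto
qed

lemma measurable_observation_history:
  assumes "s \<le> t"
  shows "(\<lambda>i. observation_history S t i s) \<in> info_space S t \<rightarrow>\<^sub>M joint_obs_space S"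
proof (cases "s + delay S \<le> t")
  case True
  have "(\<lambda>i. fst (snd i)) \<in> info_space S t \<rightarrow>\<^sub>M PiM {s. s + delay S \<le> t} (\<lambda>s. joint_obs_space S)"
    unfolding info_space_def shared_space_def by measurable
  from measurable_compose[OF this measurable_component_singleton[of s]] show ?thesis
    using True by (simp add: observation_history_def)
next
  case False
  have "(\<lambda>i. fst (fst i k) s) \<in> info_space S t \<rightarrow>\<^sub>M obs_space S k" if "k \<in> {1..members S}" for k
  proof -
    have "(\<lambda>i. fst i k) \<in> info_space S t \<rightarrow>\<^sub>M private_space S t k"
      using measurable_compose[OF measurable_fst measurable_component_singleton[OF that]]
      by (simp add: info_space_def)
    from measurable_compose[OF this, of "\<lambda>l. fst l"]
    have "(\<lambda>i. fst (fst i k)) \<in> info_space S t \<rightarrow>\<^sub>M PiM {s. s \<le> t \<and> t < s + delay S} (\<lambda>s. obs_space S k)"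
      by (simp add: private_space_def)
    from measurable_compose[OF this measurable_component_singleton[of s]] show ?thesis
      using False assms by simp
  qed
  then show ?thesis using False
    unfolding observation_history_def joint_obs_space_def by (simp add: measurable_restrict)
qed

lemma measurable_decision_history:
  assumes "s < t"
  shows "(\<lambda>i. decision_history S t i s) \<in> info_space S t \<rightarrow>\<^sub>M joint_decision_space S s"
proof (cases "s + delay S \<le> t")
  case True
  have "(\<lambda>i. snd (snd i)) \<in> info_space S t \<rightarrow>\<^sub>M PiM {s. s + delay S \<le> t} (joint_decision_space S)"
    unfolding info_space_def shared_space_def by measurable
  from measurable_compose[OF this measurable_component_singleton[of s]] show ?thesis
    using True by (simp add: decision_history_def)
next
  case False
  have "(\<lambda>i. snd (fst i k) s) \<in> info_space S t \<rightarrow>\<^sub>M decision_space S s k" if "k \<in> {1..members S}" for k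
  proof -
    have "(\<lambda>i. fst i k) \<in> info_space S t \<rightarrow>\<^sub>M private_space S t k"
      using measurable_compose[OF measurable_fst measurable_component_singleton[OF that]]
      by (simp add: info_space_def)
    from measurable_compose[OF this, of "\<lambda>l. snd l"]
    have "(\<lambda>i. snd (fst i k)) \<in> info_space S t \<rightarrow>\<^sub>M
        PiM {s. s < t \<and> t < s + delay S} (\<lambda>s. decision_space S s k)"
      by (simp add: private_space_def)
    from measurable_compose[OF this measurable_component_singleton[of s]] show ?thesis
      using False assms by simp
  qed
  then show ?thesis using False
    unfolding decision_history_def joint_decision_space_def by (simp add: measurable_restrict)
qed

text \<open>Elements of \<open>info_space\<close> are extensional in every layer, so nothing outside
  the covered times and members can distinguish \<open>i\<close> from its reconstruction.\<close>

lemma info_history: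
  assumes "i \<in> space (info_space S t)"
  shows "info S t (observation_history S t i) (decision_history S t i) = i"
proof -
  obtain p d where i: "i = (p, d)" by (cases i)
  have p: "p \<in> extensional {1..members S}"
    and pk: "\<And>k. k \<in> {1..members S} \<Longrightarrow> fst (p k) \<in> extensional {s. s \<le> t \<and> t < s + delay S} \<and>
      snd (p k) \<in> extensional {s. s < t \<and> t < s + delay S}"
    and d: "fst d \<in> extensional {s. s + delay S \<le> t}" "snd d \<in> extensional {s. s + delay S \<le> t}"
    using assms unfolding i info_space_def private_space_def shared_space_def
    by (auto simp: space_pair_measure space_PiM PiE_def Pi_def)
  have "fst d = (\<lambda>s\<in>{s. s + delay S \<le> t}. observation_history S t i s)"
    "snd d = (\<lambda>s\<in>{s. s + delay S \<le> t}. decision_history S t i s)"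
    using d by (auto simp: i observation_history_def decision_history_def extensional_def fun_eq_iff)
  moreover have "p = (\<lambda>k\<in>{1..members S}.
        (\<lambda>s\<in>{s. s \<le> t \<and> t < s + delay S}. observation_history S t i s k,
         \<lambda>s\<in>{s. s < t \<and> t < s + delay S}. decision_history S t i s k))"
  proof
    fix k
    show "p k = (\<lambda>k\<in>{1..members S}.
        (\<lambda>s\<in>{s. s \<le> t \<and> t < s + delay S}. observation_history S t i s k,
         \<lambda>s\<in>{s. s < t \<and> t < s + delay S}. decision_history S t i s k)) k"
    proof (cases "k \<in> {1..members S}")
      case True
      have "fst (p k) = (\<lambda>s\<in>{s. s \<le> t \<and> t < s + delay S}. fst (p k) s)"
        "snd (p k) = (\<lambda>s\<in>{s. s < t \<and> t < s + delay S}. snd (p k) s)"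
        using pk[OF True] by (simp_all add: extensional_restrict)
      moreover have "observation_history S t i s k = fst (p k) s" "decision_history S t i s k = snd (p k) s"
        if "t < s + delay S" for s
        using that True by (simp_all add: i observation_history_def decision_history_def)
      ultimately show ?thesis
        using True by (simp add: prod_eq_iff cong: restrict_cong)
    next
      case False
      then show ?thesis
        by (simp only: restrict_apply if_False extensional_arb[OF p False])
    qed
  qed
  ultimately show ?thesis
    unfolding info_def i by (metis prod.collapse)
qed

lemma observation_history_info:
  assumes "s \<le> t" "y s \<in> extensional {1..members S}"
  shows "observation_history S t (info S t y u) s = y s"
  using assms by (simp add: observation_history_def info_def extensional_restrict cong: restrict_cong)

lemma decision_history_info:
  assumes "s < t" "u s \<in> extensional {1..members S}"
  shows "decision_history S t (info S t y u) s = u s"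
  using assms by (simp add: decision_history_def info_def extensional_restrict cong: restrict_cong)

lemma measurable_extend_info:
  assumes [measurable]: "i \<in> N \<rightarrow>\<^sub>M info_space S t" "y \<in> N \<rightarrow>\<^sub>M joint_obs_space S"
    "a \<in> N \<rightarrow>\<^sub>M joint_decision_space S t"
  shows "(\<lambda>\<omega>. extend_info S t (i \<omega>) (y \<omega>) (a \<omega>)) \<in> N \<rightarrow>\<^sub>M info_space S (Suc t)"
proof -
  have "(\<lambda>\<omega>. info S (Suc t)
      (\<lambda>s. (\<lambda>\<omega>. if s = Suc t then y \<omega> else observation_history S t (i \<omega>) s) \<omega>)
      (\<lambda>s. (\<lambda>\<omega>. if s = t then a \<omega> else decision_history S t (i \<omega>) s) \<omega>)) \<in> N \<rightarrow>\<^sub>M info_space S (Suc t)"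
  proof (rule measurable_info)
    fix s assume "s \<le> Suc t"
    then show "(\<lambda>\<omega>. if s = Suc t then y \<omega> else observation_history S t (i \<omega>) s) \<in> N \<rightarrow>\<^sub>M joint_obs_space S"
      using measurable_compose[OF assms(1) measurable_observation_history[of s]] assms(2)
      by (cases "s = Suc t") auto
  next
    fix s assume "s < Suc t"
    then show "(\<lambda>\<omega>. if s = t then a \<omega> else decision_history S t (i \<omega>) s) \<in> N \<rightarrow>\<^sub>M joint_decision_space S s"
      using measurable_compose[OF assms(1) measurable_decision_history[of s]] assms(3)
      by (cases "s = t") auto
  qed
  then show ?thesis
    by (simp add: extend_info_def fun_upd_def)
qed

lemma measurable_truncate_info: "truncate_info S t \<in> info_space S (Suc t) \<rightarrow>\<^sub>M info_space S t"
  unfolding truncate_info_def[abs_def]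
  by (rule measurable_info) (auto intro: measurable_observation_history measurable_decision_history)

lemma strategy_measurable:
  "g \<in> strategies S \<Longrightarrow> t < horizon S \<Longrightarrow> g t \<in> info_space S t \<rightarrow>\<^sub>M joint_decision_space S t"
  by (simp add: strategies_def)

lemma measurable_joint_observation:
  assumes "t \<le> horizon S" and [measurable]: "x \<in> N \<rightarrow>\<^sub>M state_space S t"
    and z: "\<And>k. k \<in> {1..members S} \<Longrightarrow> z k \<in> N \<rightarrow>\<^sub>M obs_noise_space S t k"
  shows "(\<lambda>\<omega>. \<lambda>k\<in>{1..members S}. observation S t k (x \<omega>) (z k \<omega>)) \<in> N \<rightarrow>\<^sub>M joint_obs_space S"
  unfolding joint_obs_space_def
proof (rule measurable_restrict)
  fix k assume k: "k \<in> {1..members S}"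
  note [measurable] = observation_measurable[OF assms(1) k] z[OF k]
  show "(\<lambda>\<omega>. observation S t k (x \<omega>) (z k \<omega>)) \<in> N \<rightarrow>\<^sub>M obs_space S k" by measurable
qed

text \<open>The sigma-algebra \<open>N\<close> is left open so that one induction covers both the
  whole sample space and the sigma-algebras generated by past noises. The state at \<open>t\<close>
  needs observation noises only up to \<open>t - 1\<close>, whence the bound
  \<open>Suc b\<close>.\<close>

lemma measurable_state_information:
  assumes g: "g \<in> strategies S" and ab: "a \<le> horizon S" "b \<le> horizon S"
    and X0: "initial_state S \<in> N \<rightarrow>\<^sub>M state_space S 0"
    and W: "\<And>s. s < a \<Longrightarrow> state_noise S s \<in> N \<rightarrow>\<^sub>M state_noise_space S s"
    and Z: "\<And>s k. s \<le> b \<Longrightarrow> k \<in> {1..members S} \<Longrightarrow> obs_noise S s k \<in> N \<rightarrow>\<^sub>M obs_noise_space S s k"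
    and t: "t \<le> a"
  shows "(t \<le> Suc b \<longrightarrow> state S g t \<in> N \<rightarrow>\<^sub>M state_space S t) \<and>
    (t \<le> b \<longrightarrow> information S g t \<in> N \<rightarrow>\<^sub>M info_space S t)"
  using t
proof (induction t rule: less_induct)
  \<comment> \<open>The induction is strong because the information at \<open>t\<close> collects
    observations and decisions of all earlier times.\<close>
  case (less t)
  have dec: "decision S g s \<in> N \<rightarrow>\<^sub>M joint_decision_space S s" if "s < t" "t \<le> Suc b" for s
    unfolding decision_def[abs_def]
    using less.IH[of s] less.prems that ab g
    by (intro measurable_compose[OF _ strategy_measurable]) auto
  have st: "state S g t \<in> N \<rightarrow>\<^sub>M state_space S t" if b: "t \<le> Suc b"
  proof (cases t)
    case 0
    then show ?thesis using X0 by (simp add: state_0)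
  next
    case (Suc s)
    have "state S g s \<in> N \<rightarrow>\<^sub>M state_space S s"
      "decision S g s \<in> N \<rightarrow>\<^sub>M joint_decision_space S s"
      "state_noise S s \<in> N \<rightarrow>\<^sub>M state_noise_space S s"
      using less.IH[of s] less.prems b Suc dec W by auto
    then have arg: "(\<lambda>\<omega>. (state S g s \<omega>, decision S g s \<omega>, state_noise S s \<omega>)) \<in> N \<rightarrow>\<^sub>M
        state_space S s \<Otimes>\<^sub>M (joint_decision_space S s \<Otimes>\<^sub>M state_noise_space S s)"
      by measurable
    have dyn: "(\<lambda>(x, u, w). dynamics S s x u w) \<in>
        state_space S s \<Otimes>\<^sub>M (joint_decision_space S s \<Otimes>\<^sub>M state_noise_space S s)
          \<rightarrow>\<^sub>M state_space S (Suc s)"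
      using Suc less.prems ab by (intro dynamics_measurable) auto
    show ?thesis
      using measurable_compose[OF arg dyn] by (simp add: Suc state_Suc[abs_def])
  qed
  moreover have "information S g t \<in> N \<rightarrow>\<^sub>M info_space S t" if b: "t \<le> b"
  proof -
    have "joint_observation S g s \<in> N \<rightarrow>\<^sub>M joint_obs_space S" if s: "s \<le> t" for s
    proof -
      have "state S g s \<in> N \<rightarrow>\<^sub>M state_space S s"
        using less.IH[of s] less.prems st s b by (cases "s = t") auto
      then show ?thesis
        unfolding joint_observation_def[abs_def] observe_def
        using s b ab Z by (intro measurable_joint_observation) auto
    qed
    then show ?thesis
      unfolding information_eq[abs_def] using dec b by (intro measurable_info) auto
  qed
  ultimately show ?case by blast
qed

section \<open>Independence of the noise from the past\<close>

lemma initial_state_measurable: "initial_state S \<in> sample_space S \<rightarrow>\<^sub>M state_space S 0"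
  using initial_density by (rule distributed_measurable)

lemma state_noise_measurable:
  "t < horizon S \<Longrightarrow> state_noise S t \<in> sample_space S \<rightarrow>\<^sub>M state_noise_space S t"
  using state_noise_indep by (auto simp: indep_vars_def)

lemma obs_noise_measurable:
  "t \<le> horizon S \<Longrightarrow> k \<in> {1..members S} \<Longrightarrow> obs_noise S t k \<in> sample_space S \<rightarrow>\<^sub>M obs_noise_space S t k"
  using obs_noise_indep by (auto simp: indep_vars_def)

abbreviation state_noises :: "nat \<Rightarrow> 'o \<Rightarrow> nat \<Rightarrow> 'w" where
  "state_noises a \<equiv> \<lambda>\<omega>. \<lambda>s\<in>{..<a}. state_noise S s \<omega>"

abbreviation obs_noises :: "nat \<Rightarrow> 'o \<Rightarrow> nat \<times> nat \<Rightarrow> 'z" where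
  "obs_noises b \<equiv> \<lambda>\<omega>. \<lambda>(s, k)\<in>{..b} \<times> {1..members S}. obs_noise S s k \<omega>"

abbreviation obs_noises_space :: "nat \<Rightarrow> (nat \<times> nat \<Rightarrow> 'z) measure" where
  "obs_noises_space b \<equiv> PiM ({..b} \<times> {1..members S}) (\<lambda>(s, k). obs_noise_space S s k)"

text \<open>For a given strategy, \<open>past t t\<close> determines the state and the information
  at \<open>t\<close>. \<open>past (Suc t) t\<close> adds the noise of the transition and so
  determines the next state, but not yet its observation.\<close>

abbreviation past :: "nat \<Rightarrow> nat \<Rightarrow> 'o \<Rightarrow> (nat \<times> nat \<Rightarrow> 'z) \<times> 'x \<times> (nat \<Rightarrow> 'w)" where
  "past a b \<equiv> \<lambda>\<omega>. (obs_noises b \<omega>, initial_state S \<omega>, state_noises a \<omega>)"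

abbreviation past_space :: "nat \<Rightarrow> nat \<Rightarrow> ((nat \<times> nat \<Rightarrow> 'z) \<times> 'x \<times> (nat \<Rightarrow> 'w)) measure" where
  "past_space a b \<equiv> obs_noises_space b \<Otimes>\<^sub>M (state_space S 0 \<Otimes>\<^sub>M PiM {..<a} (state_noise_space S))"

lemma obs_noises_measurable:
  "b \<le> horizon S \<Longrightarrow> obs_noises b \<in> sample_space S \<rightarrow>\<^sub>M obs_noises_space b"
  by (rule measurable_restrict) (auto intro: obs_noise_measurable)

lemma state_noises_measurable:
  "a \<le> horizon S \<Longrightarrow> state_noises a \<in> sample_space S \<rightarrow>\<^sub>M PiM {..<a} (state_noise_space S)"
  by (rule measurable_restrict) (auto intro: state_noise_measurable)

lemma past_measurable:
  "a \<le> horizon S \<Longrightarrow> b \<le> horizon S \<Longrightarrow> past a b \<in> sample_space S \<rightarrow>\<^sub>M past_space a b"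
  by (intro measurable_Pair obs_noises_measurable initial_state_measurable state_noises_measurable)

lemma indep_initial_state_noises:
  "indep_pair (state_space S 0) (initial_state S)
    (PiM {..<horizon S} (state_noise_space S)) (state_noises (horizon S))"
  using state_noise_indep_initial initial_state_measurable state_noises_measurable[of "horizon S"]
  by (simp add: indep_pair_iff_indep_set)

lemma indep_obs_noises:
  "indep_pair (obs_noises_space (horizon S)) (obs_noises (horizon S))
    (state_space S 0 \<Otimes>\<^sub>M PiM {..<horizon S} (state_noise_space S))
    (\<lambda>\<omega>. (initial_state S \<omega>, state_noises (horizon S) \<omega>))"
  unfolding indep_pair_iff_indep_set
  by (intro conjI obs_noise_indep_rest measurable_Pair obs_noises_measurable
    initial_state_measurable state_noises_measurable order_refl)

text \<open>Two rotations: the noise is independent of the earlier state noises, and the initial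
  state and then the observation noises are moved to the side of the past.\<close>

lemma state_noise_indep_past:
  assumes t: "t < horizon S"
  shows "indep_pair (state_noise_space S t) (state_noise S t) (past_space t t) (past t t)"
proof -
  have r: "state_noises t \<omega> = restrict (state_noises (horizon S) \<omega>) {..<t}"
    "state_noise S t \<omega> = state_noises (horizon S) \<omega> t"
    "obs_noises t \<omega> = restrict (obs_noises (horizon S) \<omega>) ({..t} \<times> {1..members S})" for \<omega>
    using t by (auto simp: fun_eq_iff restrict_def)
  have m: "(\<lambda>w. restrict w {..<t}) \<in> PiM {..<horizon S} (state_noise_space S) \<rightarrow>\<^sub>M PiM {..<t} (state_noise_space S)"
    "(\<lambda>w. w t) \<in> PiM {..<horizon S} (state_noise_space S) \<rightarrow>\<^sub>M state_noise_space S t"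
    "(\<lambda>z. restrict z ({..t} \<times> {1..members S})) \<in> obs_noises_space (horizon S) \<rightarrow>\<^sub>M obs_noises_space t"
    using t by (auto intro!: measurable_restrict_subset measurable_component_singleton)
  note [measurable] = m
  \<comment> \<open>\<open>indep_var_restrict\<close> yields independence of subfamilies, so the
    single noise enters as a family indexed by \<open>{t}\<close> and is unpacked
    afterwards.\<close>
  have "indep_var (PiM {t} (state_noise_space S)) (\<lambda>\<omega>. \<lambda>s\<in>{t}. state_noise S s \<omega>)
      (PiM {..<t} (state_noise_space S)) (state_noises t)"
    using t by (intro indep_var_restrict[OF state_noise_indep]) auto
  then have "indep_pair (PiM {t} (state_noise_space S)) (\<lambda>\<omega>. \<lambda>s\<in>{t}. state_noise S s \<omega>)
      (PiM {..<t} (state_noise_space S)) (state_noises t)"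
    by (simp add: indep_var_distribution_eq indep_pair_def)
  from indep_pair_compose[OF this measurable_component_singleton[of t] measurable_ident]
  have W: "indep_pair (state_noise_space S t) (state_noise S t)
      (PiM {..<t} (state_noise_space S)) (state_noises t)"
    by simp
  have "indep_pair (state_space S 0) (initial_state S)
      (state_noise_space S t \<Otimes>\<^sub>M PiM {..<t} (state_noise_space S))
      (\<lambda>\<omega>. (state_noise S t \<omega>, state_noises t \<omega>))"
    unfolding r(1,2)
    by (rule indep_pair_compose_right[OF indep_initial_state_noises,
          where g = "\<lambda>w. (w t, restrict w {..<t})"]) measurable
  from indep_pair_rotate[OF this W]
  have XW: "indep_pair (state_noise_space S t) (state_noise S t)
      (state_space S 0 \<Otimes>\<^sub>M PiM {..<t} (state_noise_space S))
      (\<lambda>\<omega>. (initial_state S \<omega>, state_noises t \<omega>))" .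
  have "indep_pair (obs_noises_space t) (obs_noises t)
      (state_noise_space S t \<Otimes>\<^sub>M (state_space S 0 \<Otimes>\<^sub>M PiM {..<t} (state_noise_space S)))
      (\<lambda>\<omega>. (state_noise S t \<omega>, initial_state S \<omega>, state_noises t \<omega>))"
    using indep_pair_compose[OF indep_obs_noises m(3),
      where g = "\<lambda>p. (snd p t, fst p, restrict (snd p) {..<t})" and
        NB = "state_noise_space S t \<Otimes>\<^sub>M (state_space S 0 \<Otimes>\<^sub>M PiM {..<t} (state_noise_space S))"]
    unfolding r by simp
  from indep_pair_rotate[OF this XW] show ?thesis .
qed

abbreviation obs_noise_row :: "nat \<Rightarrow> 'o \<Rightarrow> nat \<Rightarrow> 'z" where
  "obs_noise_row t \<equiv> \<lambda>\<omega>. \<lambda>k\<in>{1..members S}. obs_noise S t k \<omega>"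

text \<open>The joint observation depends on the noises of all members at once, so their row is
  treated as one variable. Splitting the observation noises by time separates the row from the
  earlier ones; a rotation then adds the initial state and the state noises up to the one driving
  the transition at \<open>t\<close>.\<close>

lemma obs_noise_indep_past:
  assumes t: "t < horizon S"
  shows "indep_pair (PiM {1..members S} (obs_noise_space S (Suc t))) (obs_noise_row (Suc t))
    (past_space (Suc t) t) (past (Suc t) t)"
proof -
  let ?K = "{1..members S}"
  let ?R = "PiM ?K (obs_noise_space S (Suc t))"
  let ?XW = "\<lambda>\<omega>. (initial_state S \<omega>, state_noises (Suc t) \<omega>)"
  have r: "state_noises (Suc t) \<omega> = restrict (state_noises (horizon S) \<omega>) {..<Suc t}"
    "obs_noises t \<omega> = restrict (obs_noises (horizon S) \<omega>) ({..t} \<times> ?K)"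
    "obs_noise_row (Suc t) \<omega> = (\<lambda>k\<in>?K. obs_noises (horizon S) \<omega> (Suc t, k))" for \<omega>
    using t by (auto simp: fun_eq_iff restrict_def)
  have m: "(\<lambda>w. restrict w {..<Suc t}) \<in> PiM {..<horizon S} (state_noise_space S) \<rightarrow>\<^sub>M PiM {..<Suc t} (state_noise_space S)"
    "(\<lambda>z. restrict z ({..t} \<times> ?K)) \<in> obs_noises_space (horizon S) \<rightarrow>\<^sub>M obs_noises_space t"
    using t by (auto intro!: measurable_restrict_subset)
  have row: "(\<lambda>z. \<lambda>k\<in>?K. z (Suc t, k)) \<in> PiM J (\<lambda>(s, k). obs_noise_space S s k) \<rightarrow>\<^sub>M ?R"
    if "{Suc t} \<times> ?K \<subseteq> J" for J
  proof (rule measurable_restrict)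
    fix k assume "k \<in> ?K"
    then have "(Suc t, k) \<in> J" using that by blast
    then show "(\<lambda>z. z (Suc t, k)) \<in> PiM J (\<lambda>(s, k). obs_noise_space S s k) \<rightarrow>\<^sub>M obs_noise_space S (Suc t) k"
      using measurable_component_singleton[of "(Suc t, k)" J "\<lambda>(s, k). obs_noise_space S s k"] by simp
  qed
  note [measurable] = m row
  have "indep_var (PiM ({Suc t} \<times> ?K) (\<lambda>(s, k). obs_noise_space S s k))
      (\<lambda>\<omega>. \<lambda>p\<in>{Suc t} \<times> ?K. (\<lambda>(s, k). obs_noise S s k) p \<omega>)
      (obs_noises_space t) (\<lambda>\<omega>. \<lambda>p\<in>{..t} \<times> ?K. (\<lambda>(s, k). obs_noise S s k) p \<omega>)"
    using t by (intro indep_var_restrict[OF obs_noise_indep]) auto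
  then have "indep_pair (PiM ({Suc t} \<times> ?K) (\<lambda>(s, k). obs_noise_space S s k))
      (\<lambda>\<omega>. \<lambda>p\<in>{Suc t} \<times> ?K. (\<lambda>(s, k). obs_noise S s k) p \<omega>)
      (obs_noises_space t) (\<lambda>\<omega>. \<lambda>p\<in>{..t} \<times> ?K. (\<lambda>(s, k). obs_noise S s k) p \<omega>)"
    by (simp add: indep_var_distribution_eq indep_pair_def)
  from indep_pair_compose[OF this row measurable_ident]
  have Z: "indep_pair ?R (obs_noise_row (Suc t)) (obs_noises_space t) (obs_noises t)"
    by (simp add: case_prod_unfold cong: restrict_cong)
  have f: "(\<lambda>p. (fst p, restrict (snd p) {..<Suc t})) \<in>
      state_space S 0 \<Otimes>\<^sub>M PiM {..<horizon S} (state_noise_space S) \<rightarrow>\<^sub>M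
      state_space S 0 \<Otimes>\<^sub>M PiM {..<Suc t} (state_noise_space S)"
    by measurable
  have g: "(\<lambda>z. (\<lambda>k\<in>?K. z (Suc t, k), restrict z ({..t} \<times> ?K))) \<in>
      obs_noises_space (horizon S) \<rightarrow>\<^sub>M ?R \<Otimes>\<^sub>M obs_noises_space t"
    by (intro measurable_Pair row m(2)) (use t in auto)
  from indep_pair_compose[OF indep_pair_sym[OF indep_obs_noises] f g]
  have "indep_pair (state_space S 0 \<Otimes>\<^sub>M PiM {..<Suc t} (state_noise_space S)) ?XW
      (?R \<Otimes>\<^sub>M obs_noises_space t) (\<lambda>\<omega>. (obs_noise_row (Suc t) \<omega>, obs_noises t \<omega>))"
    unfolding r by (simp only: fst_conv snd_conv)
  from indep_pair_rotate[OF this Z]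
  have "indep_pair ?R (obs_noise_row (Suc t))
    ((state_space S 0 \<Otimes>\<^sub>M PiM {..<Suc t} (state_noise_space S)) \<Otimes>\<^sub>M obs_noises_space t)
    (\<lambda>\<omega>. (?XW \<omega>, obs_noises t \<omega>))" .
  from indep_pair_compose_right[OF this, where g = "\<lambda>p. (snd p, fst p)" and NB = "past_space (Suc t) t"]
  show ?thesis by simp
qed

lemma past_noise_measurable:
  assumes ab: "a \<le> horizon S" "b \<le> horizon S"
  defines "N \<equiv> vimage_algebra (space (sample_space S)) (past a b) (past_space a b)"
  shows "initial_state S \<in> N \<rightarrow>\<^sub>M state_space S 0"
    and "s < a \<Longrightarrow> state_noise S s \<in> N \<rightarrow>\<^sub>M state_noise_space S s"
    and "r \<le> b \<Longrightarrow> k \<in> {1..members S} \<Longrightarrow> obs_noise S r k \<in> N \<rightarrow>\<^sub>M obs_noise_space S r k"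
proof -
  have p: "past a b \<in> N \<rightarrow>\<^sub>M past_space a b"
    unfolding N_def using measurable_space[OF past_measurable[OF ab]]
    by (intro measurable_vimage_algebra1) blast
  show "initial_state S \<in> N \<rightarrow>\<^sub>M state_space S 0"
    using measurable_compose[OF p, of "\<lambda>p. fst (snd p)"] by simp
  show "state_noise S s \<in> N \<rightarrow>\<^sub>M state_noise_space S s" if "s < a"
    using measurable_compose[OF measurable_compose[OF p, of "\<lambda>p. snd (snd p)"]
      measurable_component_singleton[of s]] that by simp
  show "obs_noise S r k \<in> N \<rightarrow>\<^sub>M obs_noise_space S r k" if "r \<le> b" "k \<in> {1..members S}"
    using measurable_compose[OF measurable_compose[OF p measurable_fst]
      measurable_component_singleton[of "(r, k)"]] that by simp
qed

lemma
  assumes "g \<in> strategies S" "t \<le> horizon S"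
  shows state_measurable: "state S g t \<in> sample_space S \<rightarrow>\<^sub>M state_space S t"
    and information_measurable: "information S g t \<in> sample_space S \<rightarrow>\<^sub>M info_space S t"
  using measurable_state_information[OF assms(1) order_refl order_refl initial_state_measurable
    state_noise_measurable obs_noise_measurable, of t] assms(2)
  by auto

lemma decision_measurable:
  assumes "g \<in> strategies S" "t < horizon S"
  shows "decision S g t \<in> sample_space S \<rightarrow>\<^sub>M joint_decision_space S t"
  unfolding decision_def[abs_def]
  using assms by (intro measurable_compose[OF information_measurable strategy_measurable]) auto

text \<open>Decisions use nothing but the information, so the controlled process stays measurable
  with respect to \<open>past t t\<close> under every strategy and independence passes to it from
  the raw noises.\<close>

lemma state_noise_indep_state:
  assumes g: "g \<in> strategies S" and t: "t < horizon S"
  shows "indep_pair (state_noise_space S t) (state_noise S t)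
    (info_space S t \<Otimes>\<^sub>M state_space S t) (\<lambda>\<omega>. (information S g t \<omega>, state S g t \<omega>))"
proof (rule indep_pair_measurable_vimage[OF state_noise_indep_past[OF t]])
  have "t \<le> horizon S" using t by simp
  from measurable_state_information[OF g this this past_noise_measurable[OF this this], of t]
  show "(\<lambda>\<omega>. (information S g t \<omega>, state S g t \<omega>)) \<in>
      vimage_algebra (space (sample_space S)) (past t t) (past_space t t) \<rightarrow>\<^sub>M
      info_space S t \<Otimes>\<^sub>M state_space S t"
    by (intro measurable_Pair) auto
qed

lemma obs_noise_indep_state:
  assumes g: "g \<in> strategies S" and t: "t < horizon S"
  shows "indep_pair (PiM {1..members S} (obs_noise_space S (Suc t))) (obs_noise_row (Suc t))
    (info_space S t \<Otimes>\<^sub>M (state_space S t \<Otimes>\<^sub>M state_space S (Suc t)))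
    (\<lambda>\<omega>. (information S g t \<omega>, state S g t \<omega>, state S g (Suc t) \<omega>))"
proof (rule indep_pair_measurable_vimage[OF obs_noise_indep_past[OF t]])
  have "Suc t \<le> horizon S" "t \<le> horizon S" using t by auto
  note m = measurable_state_information[OF g this past_noise_measurable[OF this]]
  show "(\<lambda>\<omega>. (information S g t \<omega>, state S g t \<omega>, state S g (Suc t) \<omega>)) \<in>
      vimage_algebra (space (sample_space S)) (past (Suc t) t) (past_space (Suc t) t) \<rightarrow>\<^sub>M
      info_space S t \<Otimes>\<^sub>M (state_space S t \<Otimes>\<^sub>M state_space S (Suc t))"
    using m[of t] m[of "Suc t"] by (intro measurable_Pair) auto
qed

lemma sigma_finite_joint_obs: "sigma_finite_measure (joint_obs_space S)"
proof -
  \<comment> \<open>\<open>product_sigma_finite\<close> asks for a sigma-finite measure at every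
    index. Indices that are no members receive the null measure on the empty space, which leaves the
    product over the members unchanged.\<close>
  define N where "N k = (if k \<in> {1..members S} then obs_space S k else count_space {})" for k
  have "sigma_finite_measure (N k)" for k
    by (simp add: N_def sigma_finite_obs sigma_finite_measure_count_space_countable del: atLeastAtMost_iff)
  then interpret N: product_sigma_finite N
    by (simp add: product_sigma_finite_def)
  interpret N: finite_product_sigma_finite N "{1..members S}"
    by standard simp
  have "PiM {1..members S} N = joint_obs_space S"
    unfolding joint_obs_space_def by (rule PiM_cong) (auto simp: N_def)
  then show ?thesis using N.sigma_finite_measure_axioms by simp
qed

section \<open>The one-step kernel\<close>

lemma measurable_transition_density:
  assumes "t < horizon S" and [measurable]: "x \<in> N \<rightarrow>\<^sub>M state_space S t"
    "u \<in> N \<rightarrow>\<^sub>M joint_decision_space S t" "x' \<in> N \<rightarrow>\<^sub>M state_space S (Suc t)"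
  shows "(\<lambda>\<omega>. transition_density S t (x \<omega>) (u \<omega>) (x' \<omega>)) \<in> borel_measurable N"
proof -
  have "(\<lambda>\<omega>. (x \<omega>, u \<omega>, x' \<omega>)) \<in> N \<rightarrow>\<^sub>M
      state_space S t \<Otimes>\<^sub>M (joint_decision_space S t \<Otimes>\<^sub>M state_space S (Suc t))"
    by measurable
  from measurable_compose[OF this transition_density_measurable[OF assms(1)]] show ?thesis by simp
qed

lemma measurable_dynamics:
  assumes "t < horizon S" and [measurable]: "x \<in> N \<rightarrow>\<^sub>M state_space S t"
    "u \<in> N \<rightarrow>\<^sub>M joint_decision_space S t" "w \<in> N \<rightarrow>\<^sub>M state_noise_space S t"
  shows "(\<lambda>\<omega>. dynamics S t (x \<omega>) (u \<omega>) (w \<omega>)) \<in> N \<rightarrow>\<^sub>M state_space S (Suc t)"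
proof -
  have "(\<lambda>\<omega>. (x \<omega>, u \<omega>, w \<omega>)) \<in> N \<rightarrow>\<^sub>M
      state_space S t \<Otimes>\<^sub>M (joint_decision_space S t \<Otimes>\<^sub>M state_noise_space S t)"
    by measurable
  from measurable_compose[OF this dynamics_measurable[OF assms(1)]] show ?thesis by simp
qed

lemma measurable_obs_density:
  assumes "t \<le> horizon S" and [measurable]: "x \<in> N \<rightarrow>\<^sub>M state_space S t"
    "y \<in> N \<rightarrow>\<^sub>M joint_obs_space S"
  shows "(\<lambda>\<omega>. obs_density S t (x \<omega>) (y \<omega>)) \<in> borel_measurable N"
  using measurable_compose[OF measurable_Pair[OF assms(2,3)] obs_density_measurable[OF assms(1)]] by simp

text \<open>With information and state frozen, the next state is the dynamics at a fixed argument,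
  whose law has density \<open>transition_density\<close>. The integrand may depend on the
  information as well, so the noise has to be independent of the pair.\<close>

lemma nn_integral_transition:
  assumes g: "g \<in> strategies S" and t: "t < horizon S"
    and F: "(\<lambda>(i, x, x'). F i x x') \<in>
      borel_measurable (info_space S t \<Otimes>\<^sub>M (state_space S t \<Otimes>\<^sub>M state_space S (Suc t)))"
  shows "(\<integral>\<^sup>+\<omega>. F (information S g t \<omega>) (state S g t \<omega>) (state S g (Suc t) \<omega>) \<partial>sample_space S) =
    (\<integral>\<^sup>+\<omega>. (\<integral>\<^sup>+x'. transition_density S t (state S g t \<omega>) (decision S g t \<omega>) x' *
      F (information S g t \<omega>) (state S g t \<omega>) x' \<partial>state_space S (Suc t)) \<partial>sample_space S)"
proof -
  let ?f = "\<lambda>w p. F (fst p) (snd p) (dynamics S t (snd p) (g t (fst p)) w)"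
  have gt: "g t \<in> info_space S t \<rightarrow>\<^sub>M joint_decision_space S t"
    using strategy_measurable[OF g t] .
  note [measurable] = gt
  have [measurable]: "(\<lambda>p. dynamics S t (snd (snd p)) (g t (fst (snd p))) (fst p)) \<in>
      state_noise_space S t \<Otimes>\<^sub>M (info_space S t \<Otimes>\<^sub>M state_space S t) \<rightarrow>\<^sub>M state_space S (Suc t)"
    by (rule measurable_dynamics[OF t]) measurable
  have "(\<lambda>p. (fst (snd p), snd (snd p), dynamics S t (snd (snd p)) (g t (fst (snd p))) (fst p))) \<in>
      state_noise_space S t \<Otimes>\<^sub>M (info_space S t \<Otimes>\<^sub>M state_space S t) \<rightarrow>\<^sub>M
      info_space S t \<Otimes>\<^sub>M (state_space S t \<Otimes>\<^sub>M state_space S (Suc t))"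
    by measurable
  from measurable_compose[OF this F]
  have f: "(\<lambda>(w, p). ?f w p) \<in>
      borel_measurable (state_noise_space S t \<Otimes>\<^sub>M (info_space S t \<Otimes>\<^sub>M state_space S t))"
    by (simp add: case_prod_unfold)
  have "(\<integral>\<^sup>+\<omega>. F (information S g t \<omega>) (state S g t \<omega>) (state S g (Suc t) \<omega>) \<partial>sample_space S) =
      (\<integral>\<^sup>+\<omega>. ?f (state_noise S t \<omega>) (information S g t \<omega>, state S g t \<omega>) \<partial>sample_space S)"
    by (simp add: state_Suc decision_def)
  also have "\<dots> = (\<integral>\<^sup>+\<omega>. (\<integral>\<^sup>+\<omega>'. ?f (state_noise S t \<omega>') (information S g t \<omega>, state S g t \<omega>)
      \<partial>sample_space S) \<partial>sample_space S)"
    by (rule nn_integral_indep_pair[OF state_noise_indep_state[OF g t] f])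
  also have "\<dots> = (\<integral>\<^sup>+\<omega>. (\<integral>\<^sup>+x'. transition_density S t (state S g t \<omega>) (decision S g t \<omega>) x' *
      F (information S g t \<omega>) (state S g t \<omega>) x' \<partial>state_space S (Suc t)) \<partial>sample_space S)"
  proof (rule nn_integral_cong)
    fix \<omega> assume \<omega>: "\<omega> \<in> space (sample_space S)"
    have i: "information S g t \<omega> \<in> space (info_space S t)" and x: "state S g t \<omega> \<in> space (state_space S t)"
      using measurable_space[OF information_measurable[OF g] \<omega>] measurable_space[OF state_measurable[OF g] \<omega>] t
      by auto
    then have "(\<lambda>x'. (information S g t \<omega>, state S g t \<omega>, x')) \<in> state_space S (Suc t) \<rightarrow>\<^sub>M
        info_space S t \<Otimes>\<^sub>M (state_space S t \<Otimes>\<^sub>M state_space S (Suc t))"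
      by measurable
    from measurable_compose[OF this F]
    have "F (information S g t \<omega>) (state S g t \<omega>) \<in> borel_measurable (state_space S (Suc t))"
      by simp
    from distributed_nn_integral[OF transition_density[OF t x measurable_space[OF gt i]] this]
    show "(\<integral>\<^sup>+\<omega>'. ?f (state_noise S t \<omega>') (information S g t \<omega>, state S g t \<omega>) \<partial>sample_space S) =
        (\<integral>\<^sup>+x'. transition_density S t (state S g t \<omega>) (decision S g t \<omega>) x' *
          F (information S g t \<omega>) (state S g t \<omega>) x' \<partial>state_space S (Suc t))"
      by (simp add: decision_def)
  qed
  finally show ?thesis .
qed

text \<open>Once the information at \<open>t\<close> and both states are frozen, only the row of
  observation noises at \<open>Suc t\<close> remains random, and the joint density of the
  observation vector can be inserted.\<close>

lemma nn_integral_emission: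
  assumes g: "g \<in> strategies S" and t: "t < horizon S"
    and F: "(\<lambda>(c, y). F c y) \<in> borel_measurable
      ((info_space S t \<Otimes>\<^sub>M (state_space S t \<Otimes>\<^sub>M state_space S (Suc t))) \<Otimes>\<^sub>M joint_obs_space S)"
  shows "(\<integral>\<^sup>+\<omega>. F (information S g t \<omega>, state S g t \<omega>, state S g (Suc t) \<omega>)
      (joint_observation S g (Suc t) \<omega>) \<partial>sample_space S) =
    (\<integral>\<^sup>+\<omega>. (\<integral>\<^sup>+y. obs_density S (Suc t) (state S g (Suc t) \<omega>) y *
      F (information S g t \<omega>, state S g t \<omega>, state S g (Suc t) \<omega>) y \<partial>joint_obs_space S) \<partial>sample_space S)"
proof -
  let ?C = "info_space S t \<Otimes>\<^sub>M (state_space S t \<Otimes>\<^sub>M state_space S (Suc t))"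
  let ?c = "\<lambda>\<omega>. (information S g t \<omega>, state S g t \<omega>, state S g (Suc t) \<omega>)"
  let ?Z = "PiM {1..members S} (obs_noise_space S (Suc t))"
  let ?f = "\<lambda>z c. F c (\<lambda>k\<in>{1..members S}. observation S (Suc t) k (snd (snd c)) (z k))"
  have t': "Suc t \<le> horizon S" using t by simp
  have "(\<lambda>p. \<lambda>k\<in>{1..members S}. observation S (Suc t) k (snd (snd (snd p))) (fst p k)) \<in>
      ?Z \<Otimes>\<^sub>M ?C \<rightarrow>\<^sub>M joint_obs_space S"
    by (rule measurable_joint_observation[OF t'])
       (auto intro!: measurable_compose[OF measurable_fst measurable_component_singleton])
  then have "(\<lambda>p. (snd p, \<lambda>k\<in>{1..members S}. observation S (Suc t) k (snd (snd (snd p))) (fst p k))) \<in>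
      ?Z \<Otimes>\<^sub>M ?C \<rightarrow>\<^sub>M ?C \<Otimes>\<^sub>M joint_obs_space S"
    by (intro measurable_Pair) measurable
  from measurable_compose[OF this F]
  have f: "(\<lambda>(z, c). ?f z c) \<in> borel_measurable (?Z \<Otimes>\<^sub>M ?C)"
    by (simp add: case_prod_unfold)
  have row: "(\<lambda>k\<in>{1..members S}. observation S (Suc t) k x (obs_noise_row (Suc t) \<omega> k)) = observe S (Suc t) x \<omega>"
    for x \<omega>
    by (simp add: observe_def cong: restrict_cong)
  have "(\<integral>\<^sup>+\<omega>. F (?c \<omega>) (joint_observation S g (Suc t) \<omega>) \<partial>sample_space S) =
      (\<integral>\<^sup>+\<omega>. ?f (obs_noise_row (Suc t) \<omega>) (?c \<omega>) \<partial>sample_space S)"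
    by (simp only: row joint_observation_def snd_conv)
  also have "\<dots> = (\<integral>\<^sup>+\<omega>. (\<integral>\<^sup>+\<omega>'. ?f (obs_noise_row (Suc t) \<omega>') (?c \<omega>) \<partial>sample_space S) \<partial>sample_space S)"
    by (rule nn_integral_indep_pair[OF obs_noise_indep_state[OF g t] f])
  also have "\<dots> = (\<integral>\<^sup>+\<omega>. (\<integral>\<^sup>+y. obs_density S (Suc t) (state S g (Suc t) \<omega>) y * F (?c \<omega>) y
      \<partial>joint_obs_space S) \<partial>sample_space S)"
  proof (rule nn_integral_cong)
    fix \<omega> assume \<omega>: "\<omega> \<in> space (sample_space S)"
    have x: "state S g (Suc t) \<omega> \<in> space (state_space S (Suc t))"
      by (rule measurable_space[OF state_measurable[OF g t'] \<omega>])
    have "?c \<omega> \<in> space ?C"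
      using measurable_space[OF information_measurable[OF g] \<omega>, of t]
        measurable_space[OF state_measurable[OF g] \<omega>, of t] x t
      by (auto simp: space_pair_measure)
    then have "(\<lambda>y. (?c \<omega>, y)) \<in> joint_obs_space S \<rightarrow>\<^sub>M ?C \<Otimes>\<^sub>M joint_obs_space S"
      by (rule measurable_Pair1')
    from measurable_compose[OF this F]
    have "F (?c \<omega>) \<in> borel_measurable (joint_obs_space S)"
      by simp
    from distributed_nn_integral[OF obs_density[OF t' x] this]
    show "(\<integral>\<^sup>+\<omega>'. ?f (obs_noise_row (Suc t) \<omega>') (?c \<omega>) \<partial>sample_space S) =
        (\<integral>\<^sup>+y. obs_density S (Suc t) (state S g (Suc t) \<omega>) y * F (?c \<omega>) y \<partial>joint_obs_space S)"
      by (simp only: row snd_conv)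
  qed
  finally show ?thesis .
qed

text \<open>The iterated form follows the order in which a step is generated, so that emission,
  transition and the conditional density of the state can be substituted one after the
  other.\<close>

lemma nn_integral_one_step_law:
  assumes t: "t < horizon S" and [measurable]: "\<pi> \<in> borel_measurable (state_space S t)"
    and u: "u \<in> space (joint_decision_space S t)"
    and [measurable]: "f \<in> borel_measurable
      (state_space S t \<Otimes>\<^sub>M (state_space S (Suc t) \<Otimes>\<^sub>M joint_obs_space S))"
  shows "(\<integral>\<^sup>+z. f z \<partial>one_step_law S t \<pi> u) =
    (\<integral>\<^sup>+x. \<pi> x * (\<integral>\<^sup>+x'. transition_density S t x u x' *
      (\<integral>\<^sup>+y. obs_density S (Suc t) x' y * f (x, x', y) \<partial>joint_obs_space S)
        \<partial>state_space S (Suc t)) \<partial>state_space S t)"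
proof -
  have t': "Suc t \<le> horizon S" using t by simp
  let ?X = "state_space S t" and ?X' = "state_space S (Suc t)" and ?Y = "joint_obs_space S"
  interpret Y: sigma_finite_measure ?Y by (rule sigma_finite_joint_obs)
  interpret X': sigma_finite_measure ?X' by (rule sigma_finite_state[OF t'])
  interpret X'Y: pair_sigma_finite ?X' ?Y ..
  note [measurable (raw)] = measurable_transition_density[OF t] measurable_obs_density[OF t']
  note u' [measurable] = measurable_const[OF u]
  have q [measurable]: "(\<lambda>p. transition_density S t (fst p) u (snd p)) \<in> borel_measurable (?X \<Otimes>\<^sub>M ?X')"
    by (intro measurable_transition_density[OF t] u') measurable
  have r [measurable]: "(\<lambda>p. obs_density S (Suc t) (fst p) (snd p)) \<in> borel_measurable (?X' \<Otimes>\<^sub>M ?Y)"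
    by measurable
  have [measurable]: "(\<lambda>(x, x', y). \<pi> x * transition_density S t x u x' * obs_density S (Suc t) x' y) \<in>
      borel_measurable (?X \<Otimes>\<^sub>M (?X' \<Otimes>\<^sub>M ?Y))"
    using measurable_compose[OF _ q, of "\<lambda>z. (fst z, fst (snd z))" "?X \<Otimes>\<^sub>M (?X' \<Otimes>\<^sub>M ?Y)"]
    by (simp add: case_prod_unfold)
  have "(\<integral>\<^sup>+z. f z \<partial>one_step_law S t \<pi> u) =
      (\<integral>\<^sup>+z. (\<lambda>(x, x', y). \<pi> x * transition_density S t x u x' * obs_density S (Suc t) x' y) z * f z
        \<partial>(?X \<Otimes>\<^sub>M (?X' \<Otimes>\<^sub>M ?Y)))"
    unfolding one_step_law_def by (rule nn_integral_density) measurable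
  also have "\<dots> = (\<integral>\<^sup>+x. (\<integral>\<^sup>+p. \<pi> x * transition_density S t x u (fst p) *
      obs_density S (Suc t) (fst p) (snd p) * f (x, p) \<partial>(?X' \<Otimes>\<^sub>M ?Y)) \<partial>?X)"
    by (subst X'Y.nn_integral_fst[symmetric]) (auto simp: case_prod_unfold)
  also have "\<dots> = (\<integral>\<^sup>+x. (\<integral>\<^sup>+x'. (\<integral>\<^sup>+y. \<pi> x * (transition_density S t x u x' *
      (obs_density S (Suc t) x' y * f (x, x', y))) \<partial>?Y) \<partial>?X') \<partial>?X)"
  proof (rule nn_integral_cong)
    fix x assume x: "x \<in> space ?X"
    have [measurable]: "(\<lambda>x'. transition_density S t x u x') \<in> borel_measurable ?X'"
      by (rule measurable_transition_density[OF t]) (use x u in auto)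
    have [measurable]: "(\<lambda>p. f (x, p)) \<in> borel_measurable (?X' \<Otimes>\<^sub>M ?Y)"
      using x by measurable
    show "(\<integral>\<^sup>+p. \<pi> x * transition_density S t x u (fst p) *
      obs_density S (Suc t) (fst p) (snd p) * f (x, p) \<partial>(?X' \<Otimes>\<^sub>M ?Y)) =
      (\<integral>\<^sup>+x'. (\<integral>\<^sup>+y. \<pi> x * (transition_density S t x u x' *
      (obs_density S (Suc t) x' y * f (x, x', y))) \<partial>?Y) \<partial>?X')"
      by (subst Y.nn_integral_fst[symmetric]) (auto simp: mult.assoc)
  qed
  also have "\<dots> = (\<integral>\<^sup>+x. \<pi> x * (\<integral>\<^sup>+x'. transition_density S t x u x' *
      (\<integral>\<^sup>+y. obs_density S (Suc t) x' y * f (x, x', y) \<partial>?Y) \<partial>?X') \<partial>?X)"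
  proof (rule nn_integral_cong)
    fix x assume x: "x \<in> space ?X"
    have [measurable]: "(\<lambda>x'. transition_density S t x u x') \<in> borel_measurable ?X'"
      by (rule measurable_transition_density[OF t]) (use x u in auto)
    have [measurable]: "(\<lambda>p. f (x, p)) \<in> borel_measurable (?X' \<Otimes>\<^sub>M ?Y)"
      using x by measurable
    have "(\<integral>\<^sup>+x'. (\<integral>\<^sup>+y. \<pi> x * (transition_density S t x u x' *
        (obs_density S (Suc t) x' y * f (x, x', y))) \<partial>?Y) \<partial>?X') =
      (\<integral>\<^sup>+x'. \<pi> x * (transition_density S t x u x' *
        (\<integral>\<^sup>+y. obs_density S (Suc t) x' y * f (x, x', y) \<partial>?Y)) \<partial>?X')"
    proof (rule nn_integral_cong)
      fix x' assume x': "x' \<in> space ?X'"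
      have [measurable]: "(\<lambda>y. obs_density S (Suc t) x' y * f (x, x', y)) \<in> borel_measurable ?Y"
        using x' x by measurable
      show "(\<integral>\<^sup>+y. \<pi> x * (transition_density S t x u x' *
          (obs_density S (Suc t) x' y * f (x, x', y))) \<partial>?Y) =
        \<pi> x * (transition_density S t x u x' *
          (\<integral>\<^sup>+y. obs_density S (Suc t) x' y * f (x, x', y) \<partial>?Y))"
        by (simp add: nn_integral_cmult)
    qed
    also have "\<dots> = \<pi> x * (\<integral>\<^sup>+x'. transition_density S t x u x' *
      (\<integral>\<^sup>+y. obs_density S (Suc t) x' y * f (x, x', y) \<partial>?Y) \<partial>?X')"
      by (rule nn_integral_cmult) measurable
    finally show "(\<integral>\<^sup>+x'. (\<integral>\<^sup>+y. \<pi> x * (transition_density S t x u x' *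
        (obs_density S (Suc t) x' y * f (x, x', y))) \<partial>?Y) \<partial>?X') =
      \<pi> x * (\<integral>\<^sup>+x'. transition_density S t x u x' *
      (\<integral>\<^sup>+y. obs_density S (Suc t) x' y * f (x, x', y) \<partial>?Y) \<partial>?X')" .
  qed
  finally show ?thesis .
qed

section \<open>Dependence on past decisions, and recovery of earlier information\<close>

lemma trajectory_cong:
  assumes "\<And>l. l < t \<Longrightarrow> h l = h' l"
  shows "trajectory S h \<omega> t = trajectory S h' \<omega> t"
  using assms by (induction t) auto

lemma information_cong:
  "(\<And>l. l < t \<Longrightarrow> h l = h' l) \<Longrightarrow> information S h t \<omega> = information S h' t \<omega>"
  unfolding information_def by (subst trajectory_cong[of t h h']) auto

lemma joint_observation_extensional: "joint_observation S h t \<omega> \<in> extensional {1..members S}"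
  by (simp add: joint_observation_def observe_def)

text \<open>A decision is rebuilt from the members' components by restriction, which returns it only
  if it is extensional.\<close>

lemma decision_extensional:
  assumes "h \<in> strategies S" "t < horizon S" "\<omega> \<in> space (sample_space S)"
  shows "decision S h t \<omega> \<in> extensional {1..members S}"
  using measurable_space[OF decision_measurable[OF assms(1,2)] assms(3)]
  by (auto simp: joint_decision_space_def space_PiM PiE_def)

text \<open>No entry is lost when it moves from the private to the shared part, so the members
  together have perfect recall.\<close>

lemma truncate_information:
  assumes "h \<in> strategies S" "t < horizon S" "\<omega> \<in> space (sample_space S)"
  shows "truncate_info S t (information S h (Suc t) \<omega>) = information S h t \<omega>"
  unfolding truncate_info_def information_eq[of h t]
proof (rule info_cong)
  fix s assume "s \<le> t"
  then show "observation_history S (Suc t) (information S h (Suc t) \<omega>) s = joint_observation S h s \<omega>"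
    unfolding information_eq
    by (subst observation_history_info) (use joint_observation_extensional in \<open>simp_all del: One_nat_def\<close>)
next
  fix s assume "s < t"
  then show "decision_history S (Suc t) (information S h (Suc t) \<omega>) s = decision S h s \<omega>"
    unfolding information_eq
    by (subst decision_history_info) (use assms decision_extensional in \<open>simp_all del: One_nat_def\<close>)
qed

lemma extend_information:
  assumes "h \<in> strategies S" "t < horizon S" "\<omega> \<in> space (sample_space S)"
  shows "extend_info S t (information S h t \<omega>) (joint_observation S h (Suc t) \<omega>) (decision S h t \<omega>) =
    information S h (Suc t) \<omega>"
  unfolding extend_info_def information_eq[of h "Suc t"]
proof (rule info_cong)
  fix s assume "s \<le> Suc t"
  then show "((observation_history S t (information S h t \<omega>))(Suc t := joint_observation S h (Suc t) \<omega>)) s =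
      joint_observation S h s \<omega>"
    unfolding information_eq
    by (cases "s = Suc t") (use joint_observation_extensional in \<open>simp_all add: observation_history_info del: One_nat_def\<close>)
next
  fix s assume "s < Suc t"
  then show "((decision_history S t (information S h t \<omega>))(t := decision S h t \<omega>)) s = decision S h s \<omega>"
    unfolding information_eq
    by (cases "s = t") (use assms decision_extensional in \<open>simp_all add: decision_history_info del: One_nat_def\<close>)
qed

lemma stage_cost_borel_measurable:
  assumes "t < horizon S" and [measurable]: "x \<in> N \<rightarrow>\<^sub>M state_space S t"
    "u \<in> N \<rightarrow>\<^sub>M joint_decision_space S t"
  shows "(\<lambda>\<omega>. stage_cost S t (x \<omega>) (u \<omega>)) \<in> borel_measurable N"
  using measurable_compose[OF measurable_Pair[OF assms(2,3)] stage_cost_measurable[OF assms(1)]] by simp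

lemma space_one_step_law:
  "space (one_step_law S t \<pi> u) =
    space (state_space S t) \<times> space (state_space S (Suc t)) \<times> space (joint_obs_space S)"
  by (simp add: one_step_law_def space_pair_measure)

end

section \<open>The model with an information state and a strategy that attains the infimum\<close>

locale delayed_sharing_information_state = delayed_sharing S
  for S :: "('o, 'x, 'u, 'y, 'w, 'z) system" +
  fixes \<Psi> :: "nat \<Rightarrow> ('u, 'y) info \<Rightarrow> 'x \<Rightarrow> ennreal" and g :: "('u, 'y) strategy"
  assumes info_state: "information_state S \<Psi>"
    and quasi_int: "costs_quasi_integrable S"
    and strategy: "g \<in> strategies S"
    and achieves: "achieves_infimum S \<Psi> g"
begin

lemma conditional_density_state:
  "h \<in> strategies S \<Longrightarrow> t \<le> horizon S \<Longrightarrow>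
    conditional_density (sample_space S) (info_space S t) (information S h t)
      (state_space S t) (state S h t) (\<Psi> t)"
  using info_state by (simp add: information_state_def)

lemma information_state_measurable:
  "t \<le> horizon S \<Longrightarrow>
    (\<lambda>(i, x). \<Psi> t i x) \<in> borel_measurable (info_space S t \<Otimes>\<^sub>M state_space S t)"
  using conditional_density_state[OF strategy, of t] by (simp add: conditional_density_def)

text \<open>The information \<open>i\<close> is replaced by its recovered histories with the new
  observation and decision appended. The appended entries lie beyond what \<open>info S t\<close>
  reads, so the old density is still the one at \<open>i\<close>.\<close>

lemma filter_update_information_state:
  assumes t: "t < horizon S" and i: "i \<in> space (info_space S t)"
    and y: "y \<in> space (joint_obs_space S)" and a: "a \<in> space (joint_decision_space S t)"
  shows "filter_update S t (\<Psi> t i) y a = \<Psi> (Suc t) (extend_info S t i y a)"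
proof -
  let ?y = "\<lambda>s\<in>{..Suc t}. ((observation_history S t i)(Suc t := y)) s"
  let ?u = "\<lambda>s\<in>{..t}. ((decision_history S t i)(t := a)) s"
  have yh: "?y \<in> space (PiM {..Suc t} (\<lambda>s. joint_obs_space S))"
    using y measurable_space[OF measurable_observation_history i]
    by (auto simp: space_PiM)
  have uh: "?u \<in> space (PiM {..t} (joint_decision_space S))"
    using a measurable_space[OF measurable_decision_history i]
    by (auto simp: space_PiM)
  have "\<Psi> (Suc t) (info S (Suc t) ?y ?u) =
      filter_update S t (\<Psi> t (info S t ?y ?u)) (?y (Suc t)) (?u t)"
    using info_state t yh uh unfolding information_state_def by blast
  moreover have "info S (Suc t) ?y ?u = extend_info S t i y a"
    unfolding extend_info_def by (rule info_cong) auto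
  moreover have "info S t ?y ?u = info S t (observation_history S t i) (decision_history S t i)"
    by (rule info_cong) auto
  ultimately show ?thesis
    by (simp add: info_history[OF i])
qed

text \<open>The new observation, the next state and the current state are integrated out in this
  order, with \<open>E\<close> and \<open>Q\<close> as intermediate results. A bare decision rule
  \<open>d\<close> suffices for the measurability claim, which involves no trajectory.\<close>

lemma
  assumes t: "t < horizon S" and d [measurable]: "d \<in> info_space S t \<rightarrow>\<^sub>M joint_decision_space S t"
    and F: "(\<lambda>p. F (fst p) (snd p)) \<in> borel_measurable (info_space S t \<Otimes>\<^sub>M
      (state_space S t \<Otimes>\<^sub>M (state_space S (Suc t) \<Otimes>\<^sub>M joint_obs_space S)))"
  shows measurable_nn_integral_one_step_law:
      "(\<lambda>i. \<integral>\<^sup>+z. F i z \<partial>one_step_law S t (\<Psi> t i) (d i)) \<in> borel_measurable (info_space S t)"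
    and nn_integral_one_step:
      "h \<in> strategies S \<Longrightarrow> (\<And>i. i \<in> space (info_space S t) \<Longrightarrow> h t i = d i) \<Longrightarrow>
        (\<integral>\<^sup>+\<omega>. F (information S h t \<omega>)
          (state S h t \<omega>, state S h (Suc t) \<omega>, joint_observation S h (Suc t) \<omega>) \<partial>sample_space S) =
        (\<integral>\<^sup>+\<omega>. (\<integral>\<^sup>+z. F (information S h t \<omega>) z
          \<partial>one_step_law S t (\<Psi> t (information S h t \<omega>)) (decision S h t \<omega>)) \<partial>sample_space S)"
proof -
  have t': "Suc t \<le> horizon S" "t \<le> horizon S" using t by simp_all
  let ?I = "info_space S t"
  let ?X = "state_space S t" and ?X' = "state_space S (Suc t)" and ?Y = "joint_obs_space S"
  interpret Y: sigma_finite_measure ?Y by (rule sigma_finite_joint_obs)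
  interpret X': sigma_finite_measure ?X' by (rule sigma_finite_state[OF t'(1)])
  interpret X: sigma_finite_measure ?X by (rule sigma_finite_state[OF t'(2)])
  note [measurable] = information_state_measurable[OF t'(2)]
  have Fm: "(\<lambda>\<omega>. F (i \<omega>) (x \<omega>, x' \<omega>, y \<omega>)) \<in> borel_measurable N"
    if [measurable]: "i \<in> N \<rightarrow>\<^sub>M ?I" "x \<in> N \<rightarrow>\<^sub>M ?X" "x' \<in> N \<rightarrow>\<^sub>M ?X'" "y \<in> N \<rightarrow>\<^sub>M ?Y" for N :: "'n measure" and i x x' y
    using measurable_compose[OF _ F, of "\<lambda>\<omega>. (i \<omega>, x \<omega>, x' \<omega>, y \<omega>)" N] by simp
  define E where "E i x x' = (\<integral>\<^sup>+y. obs_density S (Suc t) x' y * F i (x, x', y) \<partial>?Y)" for i x x'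
  define Q where "Q i x = (\<integral>\<^sup>+x'. transition_density S t x (d i) x' * E i x x' \<partial>?X')" for i x
  have E [measurable]: "(\<lambda>(i, x, x'). E i x x') \<in> borel_measurable (?I \<Otimes>\<^sub>M (?X \<Otimes>\<^sub>M ?X'))"
  proof -
    have [measurable]: "(\<lambda>p. F (fst (fst p)) (fst (snd (fst p)), snd (snd (fst p)), snd p)) \<in>
        borel_measurable ((?I \<Otimes>\<^sub>M (?X \<Otimes>\<^sub>M ?X')) \<Otimes>\<^sub>M ?Y)"
      by (rule Fm) measurable
    have [measurable]: "(\<lambda>p. obs_density S (Suc t) (snd (snd (fst p))) (snd p)) \<in>
        borel_measurable ((?I \<Otimes>\<^sub>M (?X \<Otimes>\<^sub>M ?X')) \<Otimes>\<^sub>M ?Y)"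
      by (rule measurable_obs_density[OF t'(1)]) measurable
    show ?thesis
      unfolding E_def case_prod_unfold by (rule Y.borel_measurable_nn_integral) (simp add: case_prod_unfold)
  qed
  have Q [measurable]: "(\<lambda>(i, x). Q i x) \<in> borel_measurable (?I \<Otimes>\<^sub>M ?X)"
  proof -
    have [measurable]: "(\<lambda>p. transition_density S t (snd (fst p)) (d (fst (fst p))) (snd p)) \<in>
        borel_measurable ((?I \<Otimes>\<^sub>M ?X) \<Otimes>\<^sub>M ?X')"
      by (rule measurable_transition_density[OF t]) measurable
    have [measurable]: "(\<lambda>p. E (fst (fst p)) (snd (fst p)) (snd p)) \<in> borel_measurable ((?I \<Otimes>\<^sub>M ?X) \<Otimes>\<^sub>M ?X')"
      using measurable_compose[OF _ E, of "\<lambda>p. (fst (fst p), snd (fst p), snd p)" "(?I \<Otimes>\<^sub>M ?X) \<Otimes>\<^sub>M ?X'"]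
      by (simp add: case_prod_unfold)
    show ?thesis
      unfolding Q_def case_prod_unfold by (rule X'.borel_measurable_nn_integral) (simp add: case_prod_unfold)
  qed
  have eq: "(\<integral>\<^sup>+z. F i z \<partial>one_step_law S t (\<Psi> t i) (d i)) = (\<integral>\<^sup>+x. \<Psi> t i x * Q i x \<partial>?X)"
    if i: "i \<in> space ?I" for i
  proof -
    have "\<Psi> t i \<in> borel_measurable ?X"
      using measurable_compose[OF measurable_Pair1'[OF i] information_state_measurable[OF t'(2)]] by simp
    moreover have "F i \<in> borel_measurable (?X \<Otimes>\<^sub>M (?X' \<Otimes>\<^sub>M ?Y))"
      using measurable_compose[OF measurable_Pair1'[OF i] F] by simp
    ultimately show ?thesis
      unfolding Q_def E_def
      by (intro nn_integral_one_step_law[OF t _ measurable_space[OF d i]])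
  qed
  have "(\<lambda>i. \<integral>\<^sup>+x. \<Psi> t i x * Q i x \<partial>?X) \<in> borel_measurable ?I"
    by measurable
  then show "(\<lambda>i. \<integral>\<^sup>+z. F i z \<partial>one_step_law S t (\<Psi> t i) (d i)) \<in> borel_measurable ?I"
    by (simp add: eq cong: measurable_cong)
  assume h: "h \<in> strategies S" and hd: "\<And>i. i \<in> space ?I \<Longrightarrow> h t i = d i"
  have i: "information S h t \<omega> \<in> space ?I" if "\<omega> \<in> space (sample_space S)" for \<omega>
    using measurable_space[OF information_measurable[OF h t'(2)] that] .
  have "(\<integral>\<^sup>+\<omega>. F (information S h t \<omega>)
        (state S h t \<omega>, state S h (Suc t) \<omega>, joint_observation S h (Suc t) \<omega>) \<partial>sample_space S) =
      (\<integral>\<^sup>+\<omega>. E (information S h t \<omega>) (state S h t \<omega>) (state S h (Suc t) \<omega>) \<partial>sample_space S)"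
    using nn_integral_emission[OF h t, of "\<lambda>c y. F (fst c) (fst (snd c), snd (snd c), y)"]
      Fm[of "\<lambda>p. fst (fst p)" "(?I \<Otimes>\<^sub>M (?X \<Otimes>\<^sub>M ?X')) \<Otimes>\<^sub>M ?Y" "\<lambda>p. fst (snd (fst p))"
        "\<lambda>p. snd (snd (fst p))" snd]
    by (simp add: case_prod_unfold E_def)
  also have "\<dots> = (\<integral>\<^sup>+\<omega>. (\<integral>\<^sup>+x'. transition_density S t (state S h t \<omega>) (decision S h t \<omega>) x' *
      E (information S h t \<omega>) (state S h t \<omega>) x' \<partial>?X') \<partial>sample_space S)"
    by (rule nn_integral_transition[OF h t E])
  also have "\<dots> = (\<integral>\<^sup>+\<omega>. Q (information S h t \<omega>) (state S h t \<omega>) \<partial>sample_space S)"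
    by (rule nn_integral_cong) (simp add: Q_def decision_def hd i)
  also have "\<dots> = (\<integral>\<^sup>+\<omega>. (\<integral>\<^sup>+x. \<Psi> t (information S h t \<omega>) x * Q (information S h t \<omega>) x \<partial>?X) \<partial>sample_space S)"
    by (rule nn_integral_conditional_density[OF conditional_density_state[OF h t'(2)]
      sigma_finite_state[OF t'(2)] Q])
  also have "\<dots> = (\<integral>\<^sup>+\<omega>. (\<integral>\<^sup>+z. F (information S h t \<omega>) z
      \<partial>one_step_law S t (\<Psi> t (information S h t \<omega>)) (decision S h t \<omega>)) \<partial>sample_space S)"
    by (rule nn_integral_cong) (simp add: decision_def hd i eq)
  finally show "(\<integral>\<^sup>+\<omega>. F (information S h t \<omega>)
        (state S h t \<omega>, state S h (Suc t) \<omega>, joint_observation S h (Suc t) \<omega>) \<partial>sample_space S) =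
      (\<integral>\<^sup>+\<omega>. (\<integral>\<^sup>+z. F (information S h t \<omega>) z
        \<partial>one_step_law S t (\<Psi> t (information S h t \<omega>)) (decision S h t \<omega>)) \<partial>sample_space S)" .
qed

section \<open>Value functions along the information\<close>

text \<open>The integrand of \<open>lookahead_cost\<close> with the updated density written as the
  information state at the extended information. In this form the value function is evaluated only
  along \<Psi>, where it is measurable.\<close>

definition lookahead_integrand ::
    "nat \<Rightarrow> ('u, 'y) info \<Rightarrow> (nat \<Rightarrow> 'u) \<Rightarrow> 'x \<times> 'x \<times> (nat \<Rightarrow> 'y) \<Rightarrow> ereal" where
  "lookahead_integrand t i u z = ereal (stage_cost S t (fst z) u) +
     value_function S (Suc t) (\<Psi> (Suc t) (extend_info S t i (snd (snd z)) u))"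

lemma lookahead_cost_eq:
  assumes "t < horizon S" "i \<in> space (info_space S t)" "u \<in> space (joint_decision_space S t)"
  shows "lookahead_cost S t (value_function S (Suc t)) (\<Psi> t i) u =
    ext_expectation (one_step_law S t (\<Psi> t i) u) (lookahead_integrand t i u)"
  unfolding lookahead_cost_def
  by (rule ext_expectation_cong)
     (use assms in \<open>auto simp: space_one_step_law lookahead_integrand_def filter_update_information_state\<close>)

lemma value_function_eq_lookahead:
  assumes "t < horizon S" "i \<in> space (info_space S t)"
  shows "value_function S t (\<Psi> t i) =
    ext_expectation (one_step_law S t (\<Psi> t i) (g t i)) (lookahead_integrand t i (g t i))"
  using achieves assms measurable_space[OF strategy_measurable[OF strategy]]
  by (simp add: achieves_infimum_def flip: lookahead_cost_eq)

lemma value_function_le_lookahead: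
  assumes "t < horizon S" "i \<in> space (info_space S t)" "u \<in> space (joint_decision_space S t)"
  shows "value_function S t (\<Psi> t i) \<le>
    ext_expectation (one_step_law S t (\<Psi> t i) u) (lookahead_integrand t i u)"
  unfolding lookahead_cost_eq[OF assms, symmetric]
  by (subst value_function.simps) (use assms in \<open>auto intro: INF_lower\<close>)

lemma lookahead_integrand_measurable:
  assumes t: "t < horizon S" and d [measurable]: "d \<in> info_space S t \<rightarrow>\<^sub>M joint_decision_space S t"
    and V: "(\<lambda>i. value_function S (Suc t) (\<Psi> (Suc t) i)) \<in> borel_measurable (info_space S (Suc t))"
  shows "(\<lambda>p. lookahead_integrand t (fst p) (d (fst p)) (snd p)) \<in> borel_measurable (info_space S t \<Otimes>\<^sub>M
      (state_space S t \<Otimes>\<^sub>M (state_space S (Suc t) \<Otimes>\<^sub>M joint_obs_space S)))"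
proof -
  let ?N = "info_space S t \<Otimes>\<^sub>M (state_space S t \<Otimes>\<^sub>M (state_space S (Suc t) \<Otimes>\<^sub>M joint_obs_space S))"
  have [measurable]: "(\<lambda>p. stage_cost S t (fst (snd p)) (d (fst p))) \<in> borel_measurable ?N"
    by (rule stage_cost_borel_measurable[OF t]) measurable
  have "(\<lambda>p. extend_info S t (fst p) (snd (snd (snd p))) (d (fst p))) \<in> ?N \<rightarrow>\<^sub>M info_space S (Suc t)"
    by (rule measurable_extend_info) measurable
  note [measurable] = measurable_compose[OF this V]
  show ?thesis unfolding lookahead_integrand_def by measurable
qed

lemma terminal_integral:
  assumes i: "i \<in> space (info_space S (horizon S))"
    and f: "f \<in> borel_measurable (state_space S (horizon S))"
  shows "(\<integral>\<^sup>+x. f x \<partial>density (state_space S (horizon S)) (\<Psi> (horizon S) i)) =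
    (\<integral>\<^sup>+x. \<Psi> (horizon S) i x * f x \<partial>state_space S (horizon S))"
proof (rule nn_integral_density[OF _ f])
  show "\<Psi> (horizon S) i \<in> borel_measurable (state_space S (horizon S))"
    using measurable_compose[OF measurable_Pair1'[OF i] information_state_measurable[OF order_refl]] by simp
qed

lemma value_function_measurable:
  assumes "t \<le> horizon S"
  shows "(\<lambda>i. value_function S t (\<Psi> t i)) \<in> borel_measurable (info_space S t)"
  using assms
proof (induction rule: inc_induct)
  case base
  interpret X: sigma_finite_measure "state_space S (horizon S)" by (rule sigma_finite_state) simp
  note [measurable] = information_state_measurable[OF order_refl] final_cost_measurable
  show ?case
    by (simp add: value_function.simps ext_expectation_def terminal_integral cong: measurable_cong)
next
  case (step t)
  let ?G = "\<lambda>i. lookahead_integrand t i (g t i)"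
  have gt: "g t \<in> info_space S t \<rightarrow>\<^sub>M joint_decision_space S t"
    by (rule strategy_measurable[OF strategy step.hyps(2)])
  note [measurable] = lookahead_integrand_measurable[OF step.hyps(2) gt step.IH]
  have [measurable]: "(\<lambda>i. \<integral>\<^sup>+z. e2ennreal (?G i z) \<partial>one_step_law S t (\<Psi> t i) (g t i)) \<in>
      borel_measurable (info_space S t)"
    "(\<lambda>i. \<integral>\<^sup>+z. e2ennreal (- ?G i z) \<partial>one_step_law S t (\<Psi> t i) (g t i)) \<in>
      borel_measurable (info_space S t)"
    by (rule measurable_nn_integral_one_step_law[OF step.hyps(2) gt]; measurable)+
  have "(\<lambda>i. ext_expectation (one_step_law S t (\<Psi> t i) (g t i)) (?G i)) \<in> borel_measurable (info_space S t)"
    unfolding ext_expectation_def by measurable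
  then show ?case
    using step.hyps by (simp add: value_function_eq_lookahead cong: measurable_cong)
qed

abbreviation info_event :: "('u, 'y) strategy \<Rightarrow> nat \<Rightarrow> ('u, 'y) info set \<Rightarrow> 'o set" where
  "info_event h t A \<equiv> information S h t -` A \<inter> space (sample_space S)"

abbreviation value_process :: "('u, 'y) strategy \<Rightarrow> nat \<Rightarrow> 'o \<Rightarrow> ereal" where
  "value_process h t \<equiv> \<lambda>\<omega>. value_function S t (\<Psi> t (information S h t \<omega>))"

abbreviation lookahead_process :: "('u, 'y) strategy \<Rightarrow> nat \<Rightarrow> 'o \<Rightarrow> ereal" where
  "lookahead_process h t \<equiv> \<lambda>\<omega>.
     ext_expectation (one_step_law S t (\<Psi> t (information S h t \<omega>)) (decision S h t \<omega>))
       (lookahead_integrand t (information S h t \<omega>) (decision S h t \<omega>))"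

lemma info_event_sets:
  "h \<in> strategies S \<Longrightarrow> t \<le> horizon S \<Longrightarrow> A \<in> sets (info_space S t) \<Longrightarrow>
    info_event h t A \<in> sets (sample_space S)"
  by (rule measurable_sets[OF information_measurable])

lemma info_event_space:
  assumes "h \<in> strategies S" "t \<le> horizon S"
  shows "info_event h t (space (info_space S t)) = space (sample_space S)"
  using measurable_space[OF information_measurable[OF assms]] by auto

text \<open>The tower property tested on events: an information event contributes an indicator that
  depends on the information alone and hence passes through the inner integral.\<close>

lemma
  assumes h: "h \<in> strategies S" and t: "t < horizon S"
    and qi: "quasi_integrable (sample_space S)
      (\<lambda>\<omega>. ereal (stage_cost S t (state S h t \<omega>) (decision S h t \<omega>)) + value_process h (Suc t) \<omega>)"
  shows ext_expectation_lookahead: "A \<in> sets (info_space S t) \<Longrightarrow>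
      ext_expectation (density (sample_space S) (indicator (info_event h t A)))
        (\<lambda>\<omega>. ereal (stage_cost S t (state S h t \<omega>) (decision S h t \<omega>)) + value_process h (Suc t) \<omega>) =
      ext_expectation (density (sample_space S) (indicator (info_event h t A))) (lookahead_process h t)"
    and quasi_integrable_lookahead: "quasi_integrable (sample_space S) (lookahead_process h t)"
proof -
  let ?f = "\<lambda>\<omega>. ereal (stage_cost S t (state S h t \<omega>) (decision S h t \<omega>)) + value_process h (Suc t) \<omega>"
  let ?G = "\<lambda>i. lookahead_integrand t i (h t i)"
  let ?K = "\<lambda>\<omega>. one_step_law S t (\<Psi> t (information S h t \<omega>)) (decision S h t \<omega>)"
  let ?z = "\<lambda>\<omega>. (state S h t \<omega>, state S h (Suc t) \<omega>, joint_observation S h (Suc t) \<omega>)"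
  have ht: "h t \<in> info_space S t \<rightarrow>\<^sub>M joint_decision_space S t"
    by (rule strategy_measurable[OF h t])
  have im [measurable]: "information S h t \<in> sample_space S \<rightarrow>\<^sub>M info_space S t"
    using t by (intro information_measurable[OF h]) simp
  have G: "(\<lambda>p. ?G (fst p) (snd p)) \<in> borel_measurable (info_space S t \<Otimes>\<^sub>M
      (state_space S t \<Otimes>\<^sub>M (state_space S (Suc t) \<Otimes>\<^sub>M joint_obs_space S)))"
    using t by (intro lookahead_integrand_measurable ht value_function_measurable) auto
  have fG: "?f \<omega> = ?G (information S h t \<omega>) (?z \<omega>)" if "\<omega> \<in> space (sample_space S)" for \<omega>
    using extend_information[OF h t that] by (simp add: lookahead_integrand_def decision_def)
  \<comment> \<open>A general \<phi> covers both parts at once: the instances are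
    \<open>e2ennreal\<close> and \<open>\<lambda>x. e2ennreal (- x)\<close>.\<close>
  have *: "(\<integral>\<^sup>+\<omega>. \<phi> (?f \<omega>) \<partial>density (sample_space S) (indicator (info_event h t A))) =
      (\<integral>\<^sup>+\<omega>. (\<integral>\<^sup>+z. \<phi> (?G (information S h t \<omega>) z) \<partial>?K \<omega>)
        \<partial>density (sample_space S) (indicator (info_event h t A)))"
      "(\<lambda>\<omega>. \<integral>\<^sup>+z. \<phi> (?G (information S h t \<omega>) z) \<partial>?K \<omega>) \<in> borel_measurable (sample_space S)"
    if A [measurable]: "A \<in> sets (info_space S t)" and \<phi> [measurable]: "\<phi> \<in> borel_measurable borel"
    for A and \<phi> :: "ereal \<Rightarrow> ennreal"
  proof -
    note [measurable] = G
    have \<phi>G: "(\<lambda>p. \<phi> (?G (fst p) (snd p))) \<in> borel_measurable (info_space S t \<Otimes>\<^sub>M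
        (state_space S t \<Otimes>\<^sub>M (state_space S (Suc t) \<Otimes>\<^sub>M joint_obs_space S)))"
      by measurable
    then have \<phi>G': "(\<lambda>p. indicator A (fst p) * \<phi> (?G (fst p) (snd p))) \<in> borel_measurable (info_space S t \<Otimes>\<^sub>M
        (state_space S t \<Otimes>\<^sub>M (state_space S (Suc t) \<Otimes>\<^sub>M joint_obs_space S)))"
      by measurable
    have Km: "(\<lambda>\<omega>. \<integral>\<^sup>+z. \<phi> (?G (information S h t \<omega>) z) \<partial>?K \<omega>) \<in> borel_measurable (sample_space S)"
      using measurable_compose[OF im measurable_nn_integral_one_step_law[OF t ht \<phi>G]]
      by (simp add: decision_def)
    then show "(\<lambda>\<omega>. \<integral>\<^sup>+z. \<phi> (?G (information S h t \<omega>) z) \<partial>?K \<omega>) \<in> borel_measurable (sample_space S)" .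
    have [measurable]: "?f \<in> borel_measurable (sample_space S)"
      using qi by (simp add: quasi_integrable_def)
    have "(\<integral>\<^sup>+\<omega>. \<phi> (?f \<omega>) \<partial>density (sample_space S) (indicator (info_event h t A))) =
        (\<integral>\<^sup>+\<omega>. indicator (info_event h t A) \<omega> * \<phi> (?f \<omega>) \<partial>sample_space S)"
      by (rule nn_integral_density) measurable
    also have "\<dots> = (\<integral>\<^sup>+\<omega>. indicator A (information S h t \<omega>) * \<phi> (?G (information S h t \<omega>) (?z \<omega>)) \<partial>sample_space S)"
      by (rule nn_integral_cong) (simp add: fG indicator_def)
    also have "\<dots> = (\<integral>\<^sup>+\<omega>. (\<integral>\<^sup>+z. indicator A (information S h t \<omega>) * \<phi> (?G (information S h t \<omega>) z) \<partial>?K \<omega>)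
        \<partial>sample_space S)"
      by (rule nn_integral_one_step[OF t ht \<phi>G' h refl])
    also have "\<dots> = (\<integral>\<^sup>+\<omega>. indicator (info_event h t A) \<omega> * (\<integral>\<^sup>+z. \<phi> (?G (information S h t \<omega>) z) \<partial>?K \<omega>)
        \<partial>sample_space S)"
      by (rule nn_integral_cong) (simp add: indicator_def)
    also have "\<dots> = (\<integral>\<^sup>+\<omega>. (\<integral>\<^sup>+z. \<phi> (?G (information S h t \<omega>) z) \<partial>?K \<omega>)
        \<partial>density (sample_space S) (indicator (info_event h t A)))"
      by (rule nn_integral_density[symmetric, OF _ Km]) measurable
    finally show "(\<integral>\<^sup>+\<omega>. \<phi> (?f \<omega>) \<partial>density (sample_space S) (indicator (info_event h t A))) =
      (\<integral>\<^sup>+\<omega>. (\<integral>\<^sup>+z. \<phi> (?G (information S h t \<omega>) z) \<partial>?K \<omega>)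
        \<partial>density (sample_space S) (indicator (info_event h t A)))" .
  qed
  have dis: "quasi_integrable (density (sample_space S) (indicator (info_event h t A))) ?f"
    if "A \<in> sets (info_space S t)" for A
    using that t by (intro quasi_integrable_density_indicator[OF qi] info_event_sets[OF h]) auto
  show "ext_expectation (density (sample_space S) (indicator (info_event h t A))) ?f =
      ext_expectation (density (sample_space S) (indicator (info_event h t A))) (lookahead_process h t)"
    if A: "A \<in> sets (info_space S t)"
    unfolding decision_def[of _ _ t]
    using ext_expectation_disintegrate[OF dis[OF A] *(1)[OF A] *(1)[OF A, of "\<lambda>x. e2ennreal (- x)"]]
      *(2)[OF A, of e2ennreal] *(2)[OF A, of "\<lambda>x. e2ennreal (- x)"]
    by (simp add: decision_def)
  \<comment> \<open>The whole information space is an admissible event, and restricting to it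
    changes nothing.\<close>
  have "quasi_integrable (density (sample_space S) (indicator (info_event h t (space (info_space S t)))))
      (lookahead_process h t)"
    using quasi_integrable_disintegrate[OF dis[OF sets.top] *(1)[OF sets.top]
        *(1)[OF sets.top, of "\<lambda>x. e2ennreal (- x)"]]
      *(2)[OF sets.top, of e2ennreal] *(2)[OF sets.top, of "\<lambda>x. e2ennreal (- x)"]
    by (simp add: decision_def)
  then show "quasi_integrable (sample_space S) (lookahead_process h t)"
    using t by (simp add: info_event_space[OF h] density_indicator_space)
qed

section \<open>Comparison with the cost-to-go\<close>

lemma quasi_integrable_stage_cost:
  assumes h: "h \<in> strategies S" and t: "t < horizon S"
  shows "quasi_integrable (sample_space S) (\<lambda>\<omega>. ereal (stage_cost S t (state S h t \<omega>) (decision S h t \<omega>)))"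
proof -
  have [measurable]: "(\<lambda>\<omega>. stage_cost S t (state S h t \<omega>) (decision S h t \<omega>)) \<in> borel_measurable (sample_space S)"
    using t by (intro stage_cost_borel_measurable state_measurable decision_measurable h) auto
  show ?thesis
    using quasi_int h t unfolding quasi_integrable_def costs_quasi_integrable_def
    by (auto simp: e2ennreal_ereal)
qed

lemma quasi_integrable_final_cost:
  assumes h: "h \<in> strategies S"
  shows "quasi_integrable (sample_space S) (\<lambda>\<omega>. ereal (final_cost S (state S h (horizon S) \<omega>)))"
proof -
  note [measurable] = measurable_compose[OF state_measurable[OF h order_refl] final_cost_measurable]
  show ?thesis
    using quasi_int h unfolding quasi_integrable_def costs_quasi_integrable_def
    by (auto simp: e2ennreal_ereal)
qed

lemma quasi_integrable_cost_from:
  assumes h: "h \<in> strategies S"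
  shows "quasi_integrable (sample_space S) (\<lambda>\<omega>. ereal (cost_from S h t \<omega>))"
proof -
  have "quasi_integrable (sample_space S) (\<lambda>\<omega>.
      (\<Sum>l\<in>{t..<horizon S}. ereal (stage_cost S l (state S h l \<omega>) (decision S h l \<omega>))) +
      ereal (final_cost S (state S h (horizon S) \<omega>)))"
    by (intro quasi_integrable_add quasi_integrable_sum quasi_integrable_final_cost
        quasi_integrable_stage_cost h) auto
  then show ?thesis by (simp add: cost_from_def sum_ereal)
qed

lemma cost_from_Suc:
  "t < horizon S \<Longrightarrow>
    cost_from S h t \<omega> = stage_cost S t (state S h t \<omega>) (decision S h t \<omega>) + cost_from S h (Suc t) \<omega>"
  by (simp add: cost_from_def sum.atLeast_Suc_lessThan)

text \<open>Base of the backward induction. Only the conditional density of the terminal state given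
  the information is involved; it turns the expected terminal cost into the integral that defines
  the terminal value.\<close>

lemma
  assumes h: "h \<in> strategies S"
  defines "T \<equiv> horizon S"
  shows ext_expectation_terminal: "A \<in> sets (info_space S T) \<Longrightarrow>
      ext_expectation (density (sample_space S) (indicator (info_event h T A)))
        (\<lambda>\<omega>. ereal (final_cost S (state S h T \<omega>))) =
      ext_expectation (density (sample_space S) (indicator (info_event h T A))) (value_process h T)"
    and quasi_integrable_terminal: "quasi_integrable (sample_space S) (value_process h T)"
proof -
  have T: "T \<le> horizon S" by (simp add: T_def)
  let ?f = "\<lambda>\<omega>. ereal (final_cost S (state S h T \<omega>))"
  let ?K = "\<lambda>\<omega>. density (state_space S T) (\<Psi> T (information S h T \<omega>))"
  interpret X: sigma_finite_measure "state_space S T" by (rule sigma_finite_state[OF T])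
  have c [measurable]: "final_cost S \<in> borel_measurable (state_space S T)"
    using final_cost_measurable by (simp add: T_def)
  note [measurable] = information_state_measurable[OF T]
  have im [measurable]: "information S h T \<in> sample_space S \<rightarrow>\<^sub>M info_space S T"
    by (rule information_measurable[OF h T])
  have [measurable]: "state S h T \<in> sample_space S \<rightarrow>\<^sub>M state_space S T"
    by (rule state_measurable[OF h T])
  have i: "information S h T \<omega> \<in> space (info_space S T)" if "\<omega> \<in> space (sample_space S)" for \<omega>
    using measurable_space[OF im that] .
  have *: "(\<integral>\<^sup>+\<omega>. \<phi> (?f \<omega>) \<partial>density (sample_space S) (indicator (info_event h T A))) =
      (\<integral>\<^sup>+\<omega>. (\<integral>\<^sup>+x. \<phi> (ereal (final_cost S x)) \<partial>?K \<omega>)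
        \<partial>density (sample_space S) (indicator (info_event h T A)))"
      "(\<lambda>\<omega>. \<integral>\<^sup>+x. \<phi> (ereal (final_cost S x)) \<partial>?K \<omega>) \<in> borel_measurable (sample_space S)"
    if A [measurable]: "A \<in> sets (info_space S T)" and \<phi> [measurable]: "\<phi> \<in> borel_measurable borel"
    for A and \<phi> :: "ereal \<Rightarrow> ennreal"
  proof -
    have K: "(\<integral>\<^sup>+x. \<phi> (ereal (final_cost S x)) \<partial>?K \<omega>) =
        (\<integral>\<^sup>+x. \<Psi> T (information S h T \<omega>) x * \<phi> (ereal (final_cost S x)) \<partial>state_space S T)"
      if "\<omega> \<in> space (sample_space S)" for \<omega>
      using terminal_integral[OF i[OF that, unfolded T_def], of "\<lambda>x. \<phi> (ereal (final_cost S x))"] c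
      by (simp add: T_def)
    have Km: "(\<lambda>\<omega>. \<integral>\<^sup>+x. \<Psi> T (information S h T \<omega>) x * \<phi> (ereal (final_cost S x)) \<partial>state_space S T)
        \<in> borel_measurable (sample_space S)"
      by measurable
    then show Km': "(\<lambda>\<omega>. \<integral>\<^sup>+x. \<phi> (ereal (final_cost S x)) \<partial>?K \<omega>) \<in> borel_measurable (sample_space S)"
      by (simp add: K cong: measurable_cong)
    have "(\<integral>\<^sup>+\<omega>. \<phi> (?f \<omega>) \<partial>density (sample_space S) (indicator (info_event h T A))) =
        (\<integral>\<^sup>+\<omega>. indicator (info_event h T A) \<omega> * \<phi> (?f \<omega>) \<partial>sample_space S)"
      by (rule nn_integral_density) measurable
    also have "\<dots> = (\<integral>\<^sup>+\<omega>. indicator A (information S h T \<omega>) * \<phi> (?f \<omega>) \<partial>sample_space S)"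
      by (rule nn_integral_cong) (simp add: indicator_def)
    also have "\<dots> = (\<integral>\<^sup>+\<omega>. (\<integral>\<^sup>+x. \<Psi> T (information S h T \<omega>) x *
        (indicator A (information S h T \<omega>) * \<phi> (ereal (final_cost S x))) \<partial>state_space S T) \<partial>sample_space S)"
      by (rule nn_integral_conditional_density[OF conditional_density_state[OF h T] sigma_finite_state[OF T]])
         measurable
    also have "\<dots> = (\<integral>\<^sup>+\<omega>. indicator (info_event h T A) \<omega> *
        (\<integral>\<^sup>+x. \<phi> (ereal (final_cost S x)) \<partial>?K \<omega>) \<partial>sample_space S)"
      by (rule nn_integral_cong) (simp add: K indicator_def)
    also have "\<dots> = (\<integral>\<^sup>+\<omega>. (\<integral>\<^sup>+x. \<phi> (ereal (final_cost S x)) \<partial>?K \<omega>)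
        \<partial>density (sample_space S) (indicator (info_event h T A)))"
      by (rule nn_integral_density[symmetric, OF _ Km']) measurable
    finally show "(\<integral>\<^sup>+\<omega>. \<phi> (?f \<omega>) \<partial>density (sample_space S) (indicator (info_event h T A))) =
      (\<integral>\<^sup>+\<omega>. (\<integral>\<^sup>+x. \<phi> (ereal (final_cost S x)) \<partial>?K \<omega>)
        \<partial>density (sample_space S) (indicator (info_event h T A)))" .
  qed
  have V: "value_process h T = (\<lambda>\<omega>. ext_expectation (?K \<omega>) (\<lambda>x. ereal (final_cost S x)))"
    by (simp add: T_def value_function.simps)
  have dis: "quasi_integrable (density (sample_space S) (indicator (info_event h T A))) ?f"
    if "A \<in> sets (info_space S T)" for A
    using quasi_integrable_final_cost[OF h] info_event_sets[OF h T that]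
    unfolding T_def by (rule quasi_integrable_density_indicator)
  show "ext_expectation (density (sample_space S) (indicator (info_event h T A))) ?f =
      ext_expectation (density (sample_space S) (indicator (info_event h T A))) (value_process h T)"
    if A: "A \<in> sets (info_space S T)"
    unfolding V
    using ext_expectation_disintegrate[OF dis[OF A] *(1)[OF A] *(1)[OF A, of "\<lambda>x. e2ennreal (- x)"]]
      *(2)[OF A, of e2ennreal] *(2)[OF A, of "\<lambda>x. e2ennreal (- x)"]
    by simp
  have "quasi_integrable (density (sample_space S) (indicator (info_event h T (space (info_space S T)))))
      (value_process h T)"
    unfolding V
    using quasi_integrable_disintegrate[OF dis[OF sets.top] *(1)[OF sets.top]
        *(1)[OF sets.top, of "\<lambda>x. e2ennreal (- x)"]]
      *(2)[OF sets.top, of e2ennreal] *(2)[OF sets.top, of "\<lambda>x. e2ennreal (- x)"]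
    by simp
  then show "quasi_integrable (sample_space S) (value_process h T)"
    by (simp add: info_event_space[OF h T] density_indicator_space)
qed

text \<open>The witness is the preimage under \<open>truncate_info\<close>, since along every
  trajectory the earlier information is a function of the later one.\<close>

lemma info_event_truncate:
  assumes h: "h \<in> strategies S" and t: "t < horizon S" and A: "A \<in> sets (info_space S t)"
  obtains B where "B \<in> sets (info_space S (Suc t))" "info_event h (Suc t) B = info_event h t A"
proof
  let ?B = "truncate_info S t -` A \<inter> space (info_space S (Suc t))"
  show "?B \<in> sets (info_space S (Suc t))"
    by (rule measurable_sets[OF measurable_truncate_info A])
  show "info_event h (Suc t) ?B = info_event h t A"
  proof (rule set_eqI)
    fix \<omega>
    have "\<omega> \<in> space (sample_space S) \<Longrightarrow> information S h (Suc t) \<omega> \<in> space (info_space S (Suc t))"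
      using measurable_space[OF information_measurable[OF h]] t by simp
    then show "\<omega> \<in> info_event h (Suc t) ?B \<longleftrightarrow> \<omega> \<in> info_event h t A"
      by (cases "\<omega> \<in> space (sample_space S)") (simp_all add: truncate_information[OF h t])
  qed
qed

lemma quasi_integrable_value:
  assumes "t \<le> horizon S" "h \<in> strategies S"
  shows "quasi_integrable (sample_space S) (value_process h t)"
  using assms
proof (induction arbitrary: h rule: inc_induct)
  case base
  then show ?case by (rule quasi_integrable_terminal)
next
  case (step t)
  text \<open>The law of the information at time \<open>t\<close> only involves the decisions before \<open>t\<close>, so from
    \<open>t\<close> on the strategy may be replaced by \<open>g\<close>, for which the value is the lookahead cost.\<close>
  define h' where "h' l = (if l < t then h l else g l)" for l
  have h': "h' \<in> strategies S"
    using step.prems strategy by (simp add: strategies_def h'_def)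
  have t: "t < horizon S" by (rule step.hyps(2))
  \<comment> \<open>The induction hypothesis is applied to the spliced strategy \<open>h'\<close>,
    which is why \<open>h\<close> is generalized in the induction.\<close>
  have "quasi_integrable (sample_space S) (lookahead_process h' t)"
    by (intro quasi_integrable_lookahead h' t quasi_integrable_add quasi_integrable_stage_cost step.IH)
  moreover have "lookahead_process h' t \<omega> = value_process h t \<omega>" if "\<omega> \<in> space (sample_space S)" for \<omega>
  proof -
    have "information S h' t \<omega> = information S h t \<omega>"
      by (rule information_cong) (simp add: h'_def)
    moreover have "information S h t \<omega> \<in> space (info_space S t)"
      using measurable_space[OF information_measurable[OF step.prems] that] t by simp
    ultimately show ?thesis
      using value_function_eq_lookahead[OF t] by (simp add: decision_def h'_def)
  qed
  ultimately show ?case by (simp cong: quasi_integrable_cong)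
qed

text \<open>The event is generalized because the step represents it at the next time. Something can
  be lost only where a value is replaced by the lookahead cost of the decision taken; if
  \<open>h\<close> decides as \<open>g\<close>, nothing is, so both claims follow the same
  chain.\<close>

lemma ext_expectation_value_le:
  assumes "t \<le> horizon S" "h \<in> strategies S" "A \<in> sets (info_space S t)"
  defines "M \<equiv> density (sample_space S) (indicator (info_event h t A))"
  shows "ext_expectation M (value_process h t) \<le> ext_expectation M (\<lambda>\<omega>. ereal (cost_from S h t \<omega>)) \<and>
    ((\<forall>l\<in>{t..<horizon S}. h l = g l) \<longrightarrow>
      ext_expectation M (value_process h t) = ext_expectation M (\<lambda>\<omega>. ereal (cost_from S h t \<omega>)))"
  using assms(1-3) unfolding M_def
proof (induction arbitrary: A rule: inc_induct)
  case base
  then show ?case using ext_expectation_terminal[of h A] by (simp add: cost_from_def)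
next
  case (step t)
  note t = \<open>t < horizon S\<close> and h = \<open>h \<in> strategies S\<close> and A = \<open>A \<in> sets (info_space S t)\<close>
  let ?M = "density (sample_space S) (indicator (info_event h t A))"
  let ?c = "\<lambda>\<omega>. ereal (stage_cost S t (state S h t \<omega>) (decision S h t \<omega>))"
  obtain B where B: "B \<in> sets (info_space S (Suc t))" "info_event h (Suc t) B = info_event h t A"
    using info_event_truncate[OF h t A] .
  have E: "info_event h t A \<in> sets (sample_space S)"
    using t by (intro info_event_sets h A) simp
  have c: "quasi_integrable (sample_space S) ?c"
    by (rule quasi_integrable_stage_cost[OF h t])
  have V: "quasi_integrable (sample_space S) (value_process h (Suc t))"
    using t by (intro quasi_integrable_value h) simp
  note J = quasi_integrable_cost_from[OF h, of "Suc t"]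
  have IH: "ext_expectation ?M (value_process h (Suc t)) \<le>
      ext_expectation ?M (\<lambda>\<omega>. ereal (cost_from S h (Suc t) \<omega>))"
    "\<forall>l\<in>{Suc t..<horizon S}. h l = g l \<Longrightarrow> ext_expectation ?M (value_process h (Suc t)) =
      ext_expectation ?M (\<lambda>\<omega>. ereal (cost_from S h (Suc t) \<omega>))"
    using step.IH[OF h B(1)] by (auto simp: B(2))
  have i: "information S h t \<omega> \<in> space (info_space S t)" if "\<omega> \<in> space (sample_space S)" for \<omega>
    using measurable_space[OF information_measurable[OF h] that] t by simp
  have d: "decision S h t \<omega> \<in> space (joint_decision_space S t)" if "\<omega> \<in> space (sample_space S)" for \<omega>
    using measurable_space[OF decision_measurable[OF h t] that] .
  have "ext_expectation ?M (lookahead_process h t) =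
      ext_expectation ?M (\<lambda>\<omega>. ?c \<omega> + value_process h (Suc t) \<omega>)"
    by (rule ext_expectation_lookahead[OF h t quasi_integrable_add[OF c V] A, symmetric])
  also have "\<dots> = ext_expectation ?M ?c + ext_expectation ?M (value_process h (Suc t))"
    by (intro ext_expectation_add quasi_integrable_density_indicator c V E)
  finally have lookahead: "ext_expectation ?M (lookahead_process h t) =
    ext_expectation ?M ?c + ext_expectation ?M (value_process h (Suc t))" .
  have "ext_expectation ?M (\<lambda>\<omega>. ereal (cost_from S h t \<omega>)) =
      ext_expectation ?M (\<lambda>\<omega>. ?c \<omega> + ereal (cost_from S h (Suc t) \<omega>))"
    by (simp add: cost_from_Suc[OF t])
  also have "\<dots> = ext_expectation ?M ?c + ext_expectation ?M (\<lambda>\<omega>. ereal (cost_from S h (Suc t) \<omega>))"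
    by (intro ext_expectation_add quasi_integrable_density_indicator c J E)
  finally have cost: "ext_expectation ?M (\<lambda>\<omega>. ereal (cost_from S h t \<omega>)) =
    ext_expectation ?M ?c + ext_expectation ?M (\<lambda>\<omega>. ereal (cost_from S h (Suc t) \<omega>))" .
  show ?case
  proof (intro conjI impI)
    have "ext_expectation ?M (value_process h t) \<le> ext_expectation ?M (lookahead_process h t)"
      by (rule ext_expectation_mono) (simp add: value_function_le_lookahead[OF t i d])
    \<comment> \<open>The expected stage cost is a common summand and may be infinite; it is only
      added, never cancelled.\<close>
    also have "\<dots> \<le> ext_expectation ?M (\<lambda>\<omega>. ereal (cost_from S h t \<omega>))"
      unfolding lookahead cost by (rule add_left_mono[OF IH(1)])
    finally show "ext_expectation ?M (value_process h t) \<le>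
      ext_expectation ?M (\<lambda>\<omega>. ereal (cost_from S h t \<omega>))" .
  next
    assume hg: "\<forall>l\<in>{t..<horizon S}. h l = g l"
    then have "h t = g t" using t by simp
    then have "ext_expectation ?M (value_process h t) = ext_expectation ?M (lookahead_process h t)"
      by (intro ext_expectation_cong) (simp add: value_function_eq_lookahead[OF t i] decision_def)
    also have "\<dots> = ext_expectation ?M (\<lambda>\<omega>. ereal (cost_from S h t \<omega>))"
      unfolding lookahead cost using IH(2) hg by simp
    finally show "ext_expectation ?M (value_process h t) =
      ext_expectation ?M (\<lambda>\<omega>. ereal (cost_from S h t \<omega>))" .
  qed
qed

text \<open>At time 0 no decision has been taken, so the information and with it the value are the
  same for \<open>g\<close> and \<open>h\<close>. Both total costs are compared with this common
  value on the whole sample space.\<close>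

lemma total_cost_le:
  assumes h: "h \<in> strategies S"
  shows "total_cost S g \<le> total_cost S h"
proof -
  have V: "value_process g 0 = value_process h 0"
    using information_cong[of 0 g h] by auto
  note sp = info_event_space[OF _ le0] density_indicator_space
  have "total_cost S g = ext_expectation (sample_space S) (value_process g 0)"
    using ext_expectation_value_le[OF le0 strategy sets.top] strategy by (simp add: sp total_cost_def)
  also have "\<dots> \<le> total_cost S h"
    using ext_expectation_value_le[OF le0 h sets.top] h by (simp add: sp total_cost_def V)
  finally show ?thesis .
qed

text \<open>Every event of the sigma-algebra generated by the information is the preimage of a
  measurable set, so the equality case for \<open>g\<close> itself supplies exactly the test
  integrals that characterize the conditional expectation.\<close>

lemma value_eq_cost_to_go:
  assumes t: "t \<le> horizon S"
  shows "AE \<omega> in sample_space S. value_process g t \<omega> = cost_to_go S g t \<omega>"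
proof -
  let ?F = "vimage_algebra (space (sample_space S)) (information S g t) (info_space S t)"
  have im: "information S g t \<in> sample_space S \<rightarrow>\<^sub>M info_space S t"
    by (rule information_measurable[OF strategy t])
  have maps: "information S g t \<in> space (sample_space S) \<rightarrow> space (info_space S t)"
    using measurable_space[OF im] by auto
  have "subalgebra (sample_space S) ?F"
    using measurable_sets[OF im] by (auto simp: subalgebra_def sets_vimage_algebra2[OF maps])
  \<comment> \<open>Under a probability measure every sub-sigma-algebra is sigma-finite, as
    conditional expectation and its uniqueness require.\<close>
  then interpret F: finite_measure_subalgebra "sample_space S" ?F
    by unfold_locales
  have J: "quasi_integrable (sample_space S) (\<lambda>\<omega>. ereal (cost_from S g t \<omega>))"
    by (rule quasi_integrable_cost_from[OF strategy])
  show ?thesis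
    unfolding cost_to_go_def
  proof (rule F.AE_eqI_ext_expectation)
    show "quasi_integrable (sample_space S) (value_process g t)"
      by (rule quasi_integrable_value[OF t strategy])
    show "value_process g t \<in> borel_measurable ?F"
      by (rule measurable_compose[OF measurable_vimage_algebra1[OF maps] value_function_measurable[OF t]])
    show "quasi_integrable (sample_space S) (ext_cond_exp (sample_space S) ?F (\<lambda>\<omega>. ereal (cost_from S g t \<omega>)))"
      by (rule F.quasi_integrable_ext_cond_exp[OF J])
    show "ext_cond_exp (sample_space S) ?F (\<lambda>\<omega>. ereal (cost_from S g t \<omega>)) \<in> borel_measurable ?F"
      unfolding ext_cond_exp_def[abs_def] by measurable
  next
    fix E assume E: "E \<in> sets ?F"
    then obtain A where A: "A \<in> sets (info_space S t)" "E = info_event g t A"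
      by (auto simp: sets_vimage_algebra2[OF maps])
    show "ext_expectation (density (sample_space S) (indicator E)) (value_process g t) =
      ext_expectation (density (sample_space S) (indicator E))
        (ext_cond_exp (sample_space S) ?F (\<lambda>\<omega>. ereal (cost_from S g t \<omega>)))"
      unfolding F.ext_expectation_ext_cond_exp[OF J E]
      using ext_expectation_value_le[OF t strategy A(1)] by (simp add: A(2))
  qed
qed

end

theorem theorem3:
  fixes S :: "('o, 'x, 'u, 'y, 'w, 'z) system"
    and \<Psi> :: "nat \<Rightarrow> ('u, 'y) info \<Rightarrow> 'x \<Rightarrow> ennreal"
    and g :: "('u, 'y) strategy"
  assumes "delayed_sharing S"
    and "costs_quasi_integrable S"
    and "information_state S \<Psi>"
    and "g \<in> separated_strategies S \<Psi>"
    and "achieves_infimum S \<Psi> g"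
  shows "(\<forall>g'\<in>strategies S. total_cost S g \<le> total_cost S g') \<and>
    (\<forall>t\<le>horizon S. AE \<omega> in sample_space S.
      value_function S t (\<Psi> t (information S g t \<omega>)) = cost_to_go S g t \<omega>)"
proof -
  interpret delayed_sharing S by fact
  interpret delayed_sharing_information_state S \<Psi> g
    by unfold_locales (use assms in \<open>auto simp: separated_strategies_def\<close>)
  show ?thesis using total_cost_le value_eq_cost_to_go by blast
qed

end
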